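(* Let $(M,g)$ be a Riemannian manifold of dimension $n$. Then $(\widetilde{TM},\tilde g_2,\tilde J)$ is an almost anti-Hermitian manifold; that is, $\tilde J^2=-I$ and $\tilde g_2(\tilde JX,\tilde JY)=-\tilde g_2(X,Y)$ for all vector fields $X,Y$ on $\widetilde{TM}$.
   Context: Let $(x^i)$ be local coordinates on $M$, $(x^i,y^i)$ the induced coordinates on $TM$, $\widetilde{TM}=TM\setminus\{0\}$ the tangent bundle minus its zero section, $g_{ij}$ the components of $g$, $\Gamma_{ij}{}^k$ the Christoffel symbols of its Levi-Civita connection; the summation convention is used. Put $\|y\|=\sqrt{g_{ij}(x)y^iy^j}$. Define the local frame $X_i=\frac{\partial}{\partial x^i}-y^a\Gamma_{ai}{}^m\frac{\partial}{\partial y^m}$, $X_{\bar i}=\frac{\partial}{\partial y^i}$ of $T\widetilde{TM}$, with dual coframe $dx^i$, $\delta y^i=dy^i+y^a\Gamma_{aj}{}^i dx^j$. The pseudo-Riemannian metric $\tilde g_2=\frac{2}{\|y\|}g_{ij}(x)\,dx^i\,\delta y^j$ is the symmetric tensor with $\tilde g_2(X_i,X_j)=0=\tilde g_2(X_{\bar i},X_{\bar j})$ and $\tilde g_2(X_i,X_{\bar j})=\tilde g_2(X_{\bar j},X_i)=\frac{2}{\|y\|}g_{ij}$. $\tilde J$ is the $(1,1)$ tensor field on $\widetilde{TM}$ given by $\tilde J(X_i)=-\|y\|X_{\bar i}$, $\tilde J(X_{\bar i})=\frac1{\|y\|}X_i$. *)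

theory Defs
  imports "HOL-Analysis.Analysis"
begin

section \<open>Smooth maps between Euclidean spaces\<close>

text \<open>Only meant for open \<open>S\<close>: the derivatives are taken in the whole space, so that
  they depend only on the values of \<open>f\<close> on \<open>S\<close>.\<close>

primrec Ck_on :: "nat \<Rightarrow> 'e::euclidean_space set \<Rightarrow> ('e \<Rightarrow> 'b::real_normed_vector) \<Rightarrow> bool" where
  "Ck_on 0 S f \<longleftrightarrow> continuous_on S f"
| "Ck_on (Suc k) S f \<longleftrightarrow>
     f differentiable_on S \<and> (\<forall>v. Ck_on k S (\<lambda>x. frechet_derivative f (at x) v))"

definition smooth_on :: "'e::euclidean_space set \<Rightarrow> ('e \<Rightarrow> 'b::real_normed_vector) \<Rightarrow> bool" where
  "smooth_on S f \<longleftrightarrow> (\<forall>k. Ck_on k S f)"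


section \<open>Smooth manifolds\<close>

text \<open>A chart is a pair \<open>(U, \<phi>)\<close> of a domain and a coordinate map; the values of \<open>\<phi>\<close>
  outside \<open>U\<close> are irrelevant. A manifold is represented by a (not necessarily maximal) atlas.
  Its points are the points of the chart domains, and its topology is the one generated by the
  sets \<open>U \<inter> \<phi> -` S\<close> with \<open>S\<close> open; for a smooth atlas this is the usual topology,
  in which every \<open>\<phi>\<close> is a homeomorphism from the open set \<open>U\<close> onto its image.\<close>

type_synonym ('a, 'e) chart = "'a set \<times> ('a \<Rightarrow> 'e)"
type_synonym ('a, 'e) atlas = "('a, 'e) chart set"

definition carrier :: "('a, 'e) atlas \<Rightarrow> 'a set" where
  "carrier A = (\<Union>c\<in>A. fst c)"

definition charts_at :: "('a, 'e) atlas \<Rightarrow> 'a \<Rightarrow> ('a, 'e) chart set" where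
  "charts_at A p = {c \<in> A. p \<in> fst c}"

definition chart_image :: "('a, 'e) chart \<Rightarrow> 'e set" where
  "chart_image c = snd c ` fst c"

definition chart_inv :: "('a, 'e) chart \<Rightarrow> 'e \<Rightarrow> 'a" where
  "chart_inv c = inv_into (fst c) (snd c)"

definition transition :: "('a, 'e) chart \<Rightarrow> ('a, 'e) chart \<Rightarrow> 'e \<Rightarrow> 'e" where
  "transition c d = snd d \<circ> chart_inv c"

definition smooth_atlas :: "('a, 'e::euclidean_space) atlas \<Rightarrow> bool" where
  "smooth_atlas A \<longleftrightarrow>
     (\<forall>c\<in>A. inj_on (snd c) (fst c) \<and> open (chart_image c)) \<and>
     (\<forall>c\<in>A. \<forall>d\<in>A. open (snd c ` (fst c \<inter> fst d)) \<and>
        smooth_on (snd c ` (fst c \<inter> fst d)) (transition c d))"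

definition manifold_topology :: "('a, 'e::euclidean_space) atlas \<Rightarrow> 'a topology" where
  "manifold_topology A = topology_generated_by {fst c \<inter> snd c -` S | c S. c \<in> A \<and> open S}"

definition smooth_manifold :: "('a, 'e::euclidean_space) atlas \<Rightarrow> bool" where
  "smooth_manifold A \<longleftrightarrow>
     smooth_atlas A \<and> Hausdorff_space (manifold_topology A) \<and>
     second_countable (manifold_topology A)"


section \<open>Tangent vectors and tensor fields\<close>

text \<open>A tangent vector at \<open>p\<close> is given by its coordinates in all charts around \<open>p\<close>, which
  transform by the Jacobians of the transition maps. It is set to zero on all other charts, so
  that equality of tangent vectors is equality of functions; the vector space operations are
  the pointwise ones.\<close>

type_synonym ('a, 'e) tvec = "('a, 'e) chart \<Rightarrow> 'e"

definition tangent_space :: "('a, 'e::euclidean_space) atlas \<Rightarrow> 'a \<Rightarrow> ('a, 'e) tvec set" where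
  "tangent_space A p =
     {v. (\<forall>c\<in>charts_at A p. \<forall>d\<in>charts_at A p.
            v d = frechet_derivative (transition c d) (at (snd c p)) (v c)) \<and>
         (\<forall>c. c \<notin> charts_at A p \<longrightarrow> v c = 0)}"

text \<open>The tangent vector at \<open>p\<close> whose coordinates in the chart \<open>c\<close> are \<open>e\<close>. For the
  \<open>i\<close>-th standard basis vector \<open>e\<close> this is the \<open>i\<close>-th coordinate vector field of \<open>c\<close>
  at \<open>p\<close>.\<close>

definition coord_vector ::
    "('a, 'e::euclidean_space) atlas \<Rightarrow> ('a, 'e) chart \<Rightarrow> 'a \<Rightarrow> 'e \<Rightarrow> ('a, 'e) tvec" where
  "coord_vector A c p e =
     (\<lambda>d. if d \<in> charts_at A p
          then frechet_derivative (transition c d) (at (snd c p)) e else 0)"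

definition symmetric_bilinear_on ::
    "('a, 'e::euclidean_space) tvec set \<Rightarrow> (('a, 'e) tvec \<Rightarrow> ('a, 'e) tvec \<Rightarrow> real) \<Rightarrow> bool" where
  "symmetric_bilinear_on V b \<longleftrightarrow>
     (\<forall>v\<in>V. \<forall>w\<in>V. b v w = b w v) \<and>
     (\<forall>v\<in>V. \<forall>w\<in>V. \<forall>z\<in>V. \<forall>r s.
        b (\<lambda>c. r *\<^sub>R v c + s *\<^sub>R w c) z = r * b v z + s * b w z)"

definition endomorphism_on ::
    "('a, 'e::euclidean_space) tvec set \<Rightarrow> (('a, 'e) tvec \<Rightarrow> ('a, 'e) tvec) \<Rightarrow> bool" where
  "endomorphism_on V f \<longleftrightarrow>
     (\<forall>v\<in>V. f v \<in> V) \<and>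
     (\<forall>v\<in>V. \<forall>w\<in>V. \<forall>r s.
        f (\<lambda>c. r *\<^sub>R v c + s *\<^sub>R w c) = (\<lambda>c. r *\<^sub>R f v c + s *\<^sub>R f w c))"

definition vector_field ::
    "('a, 'e::euclidean_space) atlas \<Rightarrow> ('a \<Rightarrow> ('a, 'e) tvec) \<Rightarrow> bool" where
  "vector_field A X \<longleftrightarrow>
     (\<forall>p\<in>carrier A. X p \<in> tangent_space A p) \<and>
     (\<forall>c\<in>A. smooth_on (chart_image c) (\<lambda>x. X (chart_inv c x) c))"

definition symmetric_tensor_field ::
    "('a, 'e::euclidean_space) atlas \<Rightarrow> ('a \<Rightarrow> ('a, 'e) tvec \<Rightarrow> ('a, 'e) tvec \<Rightarrow> real) \<Rightarrow> bool" where
  "symmetric_tensor_field A h \<longleftrightarrow>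
     (\<forall>p\<in>carrier A. symmetric_bilinear_on (tangent_space A p) (h p)) \<and>
     (\<forall>c\<in>A. \<forall>e\<in>Basis. \<forall>e'\<in>Basis. smooth_on (chart_image c)
        (\<lambda>x. h (chart_inv c x) (coord_vector A c (chart_inv c x) e)
               (coord_vector A c (chart_inv c x) e')))"

definition tensor_field_11 ::
    "('a, 'e::euclidean_space) atlas \<Rightarrow> ('a \<Rightarrow> ('a, 'e) tvec \<Rightarrow> ('a, 'e) tvec) \<Rightarrow> bool" where
  "tensor_field_11 A F \<longleftrightarrow>
     (\<forall>p\<in>carrier A. endomorphism_on (tangent_space A p) (F p)) \<and>
     (\<forall>c\<in>A. \<forall>e\<in>Basis. smooth_on (chart_image c)
        (\<lambda>x. F (chart_inv c x) (coord_vector A c (chart_inv c x) e) c))"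

definition riemannian_metric ::
    "('a, 'e::euclidean_space) atlas \<Rightarrow> ('a \<Rightarrow> ('a, 'e) tvec \<Rightarrow> ('a, 'e) tvec \<Rightarrow> real) \<Rightarrow> bool" where
  "riemannian_metric A g \<longleftrightarrow>
     symmetric_tensor_field A g \<and>
     (\<forall>p\<in>carrier A. \<forall>v\<in>tangent_space A p. v \<noteq> (\<lambda>_. 0) \<longrightarrow> 0 < g p v v)"

definition pseudo_riemannian_metric ::
    "('a, 'e::euclidean_space) atlas \<Rightarrow> ('a \<Rightarrow> ('a, 'e) tvec \<Rightarrow> ('a, 'e) tvec \<Rightarrow> real) \<Rightarrow> bool" where
  "pseudo_riemannian_metric A h \<longleftrightarrow>
     symmetric_tensor_field A h \<and>
     (\<forall>p\<in>carrier A. \<forall>v\<in>tangent_space A p.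
        (\<forall>w\<in>tangent_space A p. h p v w = 0) \<longrightarrow> v = (\<lambda>_. 0))"

definition almost_anti_hermitian ::
    "('a, 'e::euclidean_space) atlas \<Rightarrow> ('a \<Rightarrow> ('a, 'e) tvec \<Rightarrow> ('a, 'e) tvec \<Rightarrow> real) \<Rightarrow>
     ('a \<Rightarrow> ('a, 'e) tvec \<Rightarrow> ('a, 'e) tvec) \<Rightarrow> bool" where
  "almost_anti_hermitian A h F \<longleftrightarrow>
     smooth_manifold A \<and> pseudo_riemannian_metric A h \<and> tensor_field_11 A F \<and>
     (\<forall>p\<in>carrier A. \<forall>v\<in>tangent_space A p. F p (F p v) = (\<lambda>c. - v c)) \<and>
     (\<forall>X Y. vector_field A X \<longrightarrow> vector_field A Y \<longrightarrow>
        (\<forall>p\<in>carrier A. h p (F p (X p)) (F p (Y p)) = - h p (X p) (Y p)))"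


section \<open>The slit tangent bundle\<close>

text \<open>The points are the pairs \<open>(p, v)\<close> with \<open>v\<close> a nonzero tangent vector at \<open>p\<close>. A chart
  \<open>c\<close> with coordinates \<open>x\<close> induces the chart with coordinates \<open>(x, y)\<close>, where \<open>y\<close>
  are the coordinates of \<open>v\<close> in \<open>c\<close>.\<close>

definition induced_chart ::
    "('a, 'e::euclidean_space) atlas \<Rightarrow> ('a, 'e) chart \<Rightarrow> ('a \<times> ('a, 'e) tvec, 'e \<times> 'e) chart" where
  "induced_chart A c =
     ({(p, v). p \<in> fst c \<and> v \<in> tangent_space A p \<and> v \<noteq> (\<lambda>_. 0)}, \<lambda>(p, v). (snd c p, v c))"

definition slit_tangent_bundle ::
    "('a, 'e::euclidean_space) atlas \<Rightarrow> ('a \<times> ('a, 'e) tvec, 'e \<times> 'e) atlas" where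
  "slit_tangent_bundle A = induced_chart A ` A"


section \<open>The induced metric and the induced almost complex structure\<close>

context
  fixes A :: "('a, real ^ 'n) atlas"
    and g :: "'a \<Rightarrow> ('a, real ^ 'n) tvec \<Rightarrow> ('a, real ^ 'n) tvec \<Rightarrow> real"
begin

definition g_matrix :: "('a, real ^ 'n) chart \<Rightarrow> real ^ 'n \<Rightarrow> real ^ 'n ^ 'n" where
  "g_matrix c x = (\<chi> i j. g (chart_inv c x)
     (coord_vector A c (chart_inv c x) (axis i 1)) (coord_vector A c (chart_inv c x) (axis j 1)))"

definition dg :: "('a, real ^ 'n) chart \<Rightarrow> real ^ 'n \<Rightarrow> 'n \<Rightarrow> 'n \<Rightarrow> 'n \<Rightarrow> real" where
  "dg c x k i j = frechet_derivative (\<lambda>x. g_matrix c x $ i $ j) (at x) (axis k 1)"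

text \<open>The Christoffel symbol \<open>\<Gamma>\<close> of the Levi-Civita connection with lower indices
  \<open>i j\<close> and upper index \<open>k\<close>; the matrix inverse supplies \<open>g\<close> with upper indices.\<close>

definition christoffel :: "('a, real ^ 'n) chart \<Rightarrow> real ^ 'n \<Rightarrow> 'n \<Rightarrow> 'n \<Rightarrow> 'n \<Rightarrow> real" where
  "christoffel c x i j k =
     (\<Sum>l\<in>UNIV. matrix_inv (g_matrix c x) $ k $ l *
        (dg c x i j l + dg c x j i l - dg c x l i j)) / 2"

definition fibre_norm :: "('a, real ^ 'n) chart \<Rightarrow> 'a \<times> ('a, real ^ 'n) tvec \<Rightarrow> real" where
  "fibre_norm c u = (let (x, y) = snd (induced_chart A c) u in
     sqrt (\<Sum>i\<in>UNIV. \<Sum>j\<in>UNIV. g_matrix c x $ i $ j * y $ i * y $ j))"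

definition horizontal_frame ::
    "('a, real ^ 'n) chart \<Rightarrow> 'a \<times> ('a, real ^ 'n) tvec \<Rightarrow> 'n \<Rightarrow>
     ('a \<times> ('a, real ^ 'n) tvec, (real ^ 'n) \<times> (real ^ 'n)) tvec" where
  "horizontal_frame c u i = (let (x, y) = snd (induced_chart A c) u in
     coord_vector (slit_tangent_bundle A) (induced_chart A c) u
       (axis i 1, \<chi> m. - (\<Sum>a\<in>UNIV. y $ a * christoffel c x a i m)))"

definition vertical_frame ::
    "('a, real ^ 'n) chart \<Rightarrow> 'a \<times> ('a, real ^ 'n) tvec \<Rightarrow> 'n \<Rightarrow>
     ('a \<times> ('a, real ^ 'n) tvec, (real ^ 'n) \<times> (real ^ 'n)) tvec" where
  "vertical_frame c u i =
     coord_vector (slit_tangent_bundle A) (induced_chart A c) u (0, axis i 1)"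

text \<open>At each point \<open>u\<close>, the two tensors are the bilinear form and the endomorphism with the
  prescribed values on the frames of \<^emph>\<open>all\<close> charts around the base point of \<open>u\<close>;
  in particular they do not depend on a choice of chart. They are set to zero outside the
  tangent space, which makes the descriptions definite.\<close>

definition g2_tilde ::
    "'a \<times> ('a, real ^ 'n) tvec \<Rightarrow>
     ('a \<times> ('a, real ^ 'n) tvec, (real ^ 'n) \<times> (real ^ 'n)) tvec \<Rightarrow>
     ('a \<times> ('a, real ^ 'n) tvec, (real ^ 'n) \<times> (real ^ 'n)) tvec \<Rightarrow> real" where
  "g2_tilde u = (THE b.
     symmetric_bilinear_on (tangent_space (slit_tangent_bundle A) u) b \<and>
     (\<forall>v w. v \<notin> tangent_space (slit_tangent_bundle A) u \<or>
            w \<notin> tangent_space (slit_tangent_bundle A) u \<longrightarrow> b v w = 0) \<and>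
     (\<forall>c\<in>charts_at A (fst u). \<forall>i j.
        b (horizontal_frame c u i) (horizontal_frame c u j) = 0 \<and>
        b (vertical_frame c u i) (vertical_frame c u j) = 0 \<and>
        b (horizontal_frame c u i) (vertical_frame c u j) =
          2 / fibre_norm c u * g_matrix c (snd c (fst u)) $ i $ j))"

definition J_tilde ::
    "'a \<times> ('a, real ^ 'n) tvec \<Rightarrow>
     ('a \<times> ('a, real ^ 'n) tvec, (real ^ 'n) \<times> (real ^ 'n)) tvec \<Rightarrow>
     ('a \<times> ('a, real ^ 'n) tvec, (real ^ 'n) \<times> (real ^ 'n)) tvec" where
  "J_tilde u = (THE f.
     endomorphism_on (tangent_space (slit_tangent_bundle A) u) f \<and>
     (\<forall>v. v \<notin> tangent_space (slit_tangent_bundle A) u \<longrightarrow> f v = (\<lambda>_. 0)) \<and>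
     (\<forall>c\<in>charts_at A (fst u). \<forall>i.
        f (horizontal_frame c u i) = (\<lambda>d. - fibre_norm c u *\<^sub>R vertical_frame c u i d) \<and>
        f (vertical_frame c u i) = (\<lambda>d. (1 / fibre_norm c u) *\<^sub>R horizontal_frame c u i d)))"

end

end

(* In the chart of the slit tangent bundle induced by a chart of M, a tangent vector (a, b) at (x, y)
   has the horizontal component a and the vertical component b + Gamma(y, a). In terms of these,
   with N = |y|, g2 is 2/N (g(a, w') + g(a', w)) and J sends (a, w) to (w/N, -N a), so J^2 = -I, the
   anti-invariance and the nondegeneracy of g2 are immediate. The substance is that g2 and J, which
   are required to have the prescribed values on the frames of all charts simultaneously, exist:
   under a change of charts F the frames are related by the Jacobian DF, because
   DF Gamma(a, b) = D^2F(a, b) + Gamma'(DF a, DF b). This follows from the Koszul formula for Gamma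
   and the symmetry of D^2F. *)

theory Submission
  imports Defs
begin

section \<open>Calculus of smooth maps\<close>

text \<open>\<open>g2_tilde\<close> and \<open>J_tilde\<close> are definite descriptions over total
  functions, so nothing can be said about them before an object with the prescribed frame values is
  exhibited and shown to be unique. Uniqueness uses a single chart, whose horizontal and vertical
  frames span the tangent space; the value zero outside that space settles the rest. For existence,
  the indexed frames are replaced by lifts that are linear in a vector of the base, so that
  compatibility of two charts becomes one equation for each kind of lift. The transformation law of
  Gamma is tested with the metric against all vectors, which removes the inverse matrix from the
  definition of Gamma. The zero section is left out because N is a divisor and must stay smooth. The
  weights N and 1/N in J cancel both in J^2 and in g2(JX, JY), leaving only the sign. Besides this
  algebra, the slit tangent bundle has to be a Hausdorff, second countable manifold, and Gamma has
  to be smooth.\<close>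

lemma frechet_derivative_cong_open:
  assumes "open S" "x \<in> S" "\<And>y. y \<in> S \<Longrightarrow> f y = g y"
  shows "frechet_derivative f (at x) = frechet_derivative g (at x)"
proof -
  \<comment> \<open>\<open>frechet_derivative\<close> chooses from the relation
    \<open>has_derivative\<close>, so it suffices that this relation is the same for both functions;
    differentiability does not enter.\<close>
  have "(f has_derivative f') (at x) \<longleftrightarrow> (g has_derivative f') (at x)" for f'
    using assms by (metis has_derivative_transform_within_open)
  then show ?thesis
    unfolding frechet_derivative_def by simp
qed

lemma Ck_on_Suc_imp_has_derivative:
  assumes "open S" "Ck_on (Suc k) S f" "x \<in> S"
  shows "(f has_derivative frechet_derivative f (at x)) (at x)"
  using assms by (auto simp: frechet_derivative_works[symmetric] differentiable_on_eq_differentiable_at)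

lemma Ck_on_Suc_imp_Ck_on: "Ck_on (Suc k) S f \<Longrightarrow> Ck_on k S f"
  by (induction k arbitrary: f) (auto intro: differentiable_imp_continuous_on)

lemma Ck_on_cong:
  assumes "open S" "\<And>x. x \<in> S \<Longrightarrow> f x = g x" "Ck_on k S f"
  shows "Ck_on k S g"
  using assms(2,3)
proof (induction k arbitrary: f g)
  case 0
  then show ?case by (simp cong: continuous_on_cong)
next
  case (Suc k)
  have "g differentiable_on S"
    using Suc.prems by (auto simp: differentiable_on_def intro: differentiable_transform_within[OF _ zero_less_one])
  moreover have "Ck_on k S (\<lambda>x. frechet_derivative g (at x) v)" for v
  proof (rule Suc.IH)
    show "frechet_derivative f (at x) v = frechet_derivative g (at x) v" if "x \<in> S" for x
      using frechet_derivative_cong_open[OF assms(1) that, of f g] Suc.prems(1) by simp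
    show "Ck_on k S (\<lambda>x. frechet_derivative f (at x) v)"
      using Suc.prems(2) by simp
  qed
  ultimately show ?case by simp
qed

text \<open>Derivatives at a point are unique, so the recursion of \<open>Ck_on\<close> may be run
  on any explicit formula for the derivative. All inductions below supply the formula of the
  relevant differentiation rule.\<close>

lemma Ck_on_SucI:
  assumes "open S" "\<And>x. x \<in> S \<Longrightarrow> (f has_derivative f' x) (at x)"
    and "\<And>v. Ck_on k S (\<lambda>x. f' x v)"
  shows "Ck_on (Suc k) S f"
proof -
  have "f differentiable_on S"
    using assms(1,2) by (auto simp: differentiable_on_eq_differentiable_at differentiable_def)
  moreover have "Ck_on k S (\<lambda>x. frechet_derivative f (at x) v)" for v
    by (rule Ck_on_cong[OF assms(1) _ assms(3)[of v]]) (metis assms(2) frechet_derivative_at)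
  ultimately show ?thesis by simp
qed

lemma Ck_on_const: "open S \<Longrightarrow> Ck_on k S (\<lambda>x. c)"
  by (induction k arbitrary: c) (simp_all add: differentiable_on_const)

lemma Ck_on_bounded_linear:
  assumes "open S" "bounded_linear L"
  shows "Ck_on k S L"
proof (cases k)
  case 0
  then show ?thesis using assms by (simp add: linear_continuous_on)
next
  case (Suc m)
  show ?thesis unfolding Suc
    by (rule Ck_on_SucI[where f' = "\<lambda>_. L"])
      (auto simp: assms Ck_on_const bounded_linear_imp_has_derivative)
qed

lemma Ck_on_add:
  assumes "open S" "Ck_on k S f" "Ck_on k S g"
  shows "Ck_on k S (\<lambda>x. f x + g x)"
  using assms(2,3)
proof (induction k arbitrary: f g)
  case 0
  then show ?case by (simp add: continuous_on_add)
next
  case (Suc k)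
  show ?case
  proof (rule Ck_on_SucI[OF assms(1)])
    show "((\<lambda>x. f x + g x) has_derivative
        (\<lambda>v. frechet_derivative f (at x) v + frechet_derivative g (at x) v)) (at x)" if "x \<in> S" for x
      using Suc.prems that by (intro has_derivative_add Ck_on_Suc_imp_has_derivative[OF assms(1)])
  qed (use Suc in auto)
qed

lemma Ck_on_linear_compose:
  assumes "open S" "bounded_linear L" "Ck_on k S f"
  shows "Ck_on k S (\<lambda>x. L (f x))"
  using assms(3)
proof (induction k arbitrary: f)
  case 0
  then show ?case using assms(2) by (simp add: bounded_linear.continuous_on)
next
  case (Suc k)
  show ?case
  proof (rule Ck_on_SucI[OF assms(1)])
    show "((\<lambda>x. L (f x)) has_derivative (\<lambda>v. L (frechet_derivative f (at x) v))) (at x)"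
      if "x \<in> S" for x
      using Suc.prems that
      by (intro bounded_linear.has_derivative[OF assms(2)] Ck_on_Suc_imp_has_derivative[OF assms(1)])
  qed (use Suc in auto)
qed

text \<open>By the product rule the derivative is a sum of two products of the same kind. The
  undifferentiated factors are lowered from order k+1 to k before the induction hypothesis is
  applied.\<close>

lemma Ck_on_bounded_bilinear:
  assumes "bounded_bilinear B" "open S" "Ck_on k S f" "Ck_on k S g"
  shows "Ck_on k S (\<lambda>x. B (f x) (g x))"
  using assms(3,4)
proof (induction k arbitrary: f g)
  case 0
  then show ?case by (simp add: bounded_bilinear.continuous_on[OF assms(1)])
next
  case (Suc k)
  show ?case
  proof (rule Ck_on_SucI[OF assms(2)])
    show "((\<lambda>x. B (f x) (g x)) has_derivative
        (\<lambda>v. B (f x) (frechet_derivative g (at x) v) + B (frechet_derivative f (at x) v) (g x))) (at x)"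
      if "x \<in> S" for x
      using Suc.prems that
      by (intro bounded_bilinear.FDERIV[OF assms(1)] Ck_on_Suc_imp_has_derivative[OF assms(2)])
    show "Ck_on k S (\<lambda>x. B (f x) (frechet_derivative g (at x) v) + B (frechet_derivative f (at x) v) (g x))" for v
      using Suc.prems Ck_on_Suc_imp_Ck_on[OF Suc.prems(1)] Ck_on_Suc_imp_Ck_on[OF Suc.prems(2)]
      by (intro Ck_on_add[OF assms(2)] Suc.IH) auto
  qed
qed

lemma Ck_on_sum:
  assumes "open S" "\<And>i. i \<in> I \<Longrightarrow> Ck_on k S (f i)"
  shows "Ck_on k S (\<lambda>x. \<Sum>i\<in>I. f i x)"
  using assms(2)
  by (induction I rule: infinite_finite_induct) (auto intro!: Ck_on_const Ck_on_add assms(1))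

text \<open>\<open>Ck_on\<close> controls derivatives in fixed directions only. This expansion
  handles a derivative applied to a vector that itself varies with the point.\<close>

lemma linear_eq_sum_Basis:
  fixes L :: "'e::euclidean_space \<Rightarrow> 'b::real_vector"
  assumes "linear L"
  shows "L v = (\<Sum>b\<in>Basis. (v \<bullet> b) *\<^sub>R L b)"
proof -
  have "L v = L (\<Sum>b\<in>Basis. (v \<bullet> b) *\<^sub>R b)"
    by (simp add: euclidean_representation)
  then show ?thesis
    by (simp add: linear_sum[OF assms] linear_scale[OF assms] o_def)
qed

lemma Ck_on_compose:
  fixes f :: "'d::euclidean_space \<Rightarrow> 'e::euclidean_space" and g :: "'e \<Rightarrow> 'b::real_normed_vector"
  assumes "open S" "open T" "f ` S \<subseteq> T" "Ck_on k S f" "Ck_on k T g"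
  shows "Ck_on k S (\<lambda>x. g (f x))"
  using assms(4,5)
proof (induction k arbitrary: g)
  case 0
  then show ?case using assms(3) by (auto intro: continuous_on_compose2)
next
  case (Suc k)
  let ?Dg = "\<lambda>x. frechet_derivative g (at (f x))" and ?Df = "\<lambda>x. frechet_derivative f (at x)"
  show ?case
  proof (rule Ck_on_SucI[OF assms(1)])
    \<comment> \<open>The chain rule is written in a basis: the direction \<open>?Df x v\<close>
      moves with x, whereas \<open>?Dg x b\<close> is a directional derivative of g composed with f,
      to which the induction hypothesis, general in g, applies.\<close>
    show "((\<lambda>x. g (f x)) has_derivative (\<lambda>v. \<Sum>b\<in>Basis. (?Df x v \<bullet> b) *\<^sub>R ?Dg x b)) (at x)"
      if "x \<in> S" for x
    proof -
      have g: "(g has_derivative ?Dg x) (at (f x))"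
        using Suc.prems assms that by (intro Ck_on_Suc_imp_has_derivative[of T]) auto
      have f: "(f has_derivative ?Df x) (at x)"
        using Suc.prems assms that by (intro Ck_on_Suc_imp_has_derivative[of S]) auto
      show ?thesis
        by (rule has_derivative_eq_rhs[OF has_derivative_compose[OF f g]])
          (rule ext, rule linear_eq_sum_Basis[OF has_derivative_linear[OF g]])
    qed
    show "Ck_on k S (\<lambda>x. \<Sum>b\<in>Basis. (?Df x v \<bullet> b) *\<^sub>R ?Dg x b)" for v
    proof (rule Ck_on_sum[OF assms(1)], rule Ck_on_bounded_bilinear[OF bounded_bilinear_scaleR assms(1)])
      fix b
      show "Ck_on k S (\<lambda>x. ?Df x v \<bullet> b)"
        using Suc.prems(1)
        by (intro Ck_on_linear_compose[OF assms(1) bounded_linear_inner_left]) auto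
      show "Ck_on k S (\<lambda>x. ?Dg x b)"
        using Suc.prems Ck_on_Suc_imp_Ck_on[OF Suc.prems(1)] by (intro Suc.IH) auto
    qed
  qed
qed

text \<open>The derivative is a polynomial in \<open>inverse\<close> itself, so each order of
  differentiability yields the next.\<close>

lemma Ck_on_inverse: "Ck_on k {x::real. x \<noteq> 0} inverse"
proof (induction k)
  case 0
  then show ?case by (auto intro!: continuous_intros)
next
  case (Suc k)
  have op: "open {x::real. x \<noteq> 0}"
    by (simp add: open_Collect_neq)
  show ?case
  proof (rule Ck_on_SucI[OF op])
    show "(inverse has_derivative (\<lambda>v. - v * (inverse x * inverse x))) (at x)"
      if "x \<in> {x::real. x \<noteq> 0}" for x
      using has_derivative_inverse'[of x] that by (simp add: algebra_simps)
    show "Ck_on k {x::real. x \<noteq> 0} (\<lambda>x. - v * (inverse x * inverse x))" for v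
      using Suc
      by (intro Ck_on_linear_compose[OF op bounded_linear_mult_right]
          Ck_on_bounded_bilinear[OF bounded_bilinear_mult op])
  qed
qed

lemma Ck_on_sqrt: "Ck_on k {0<..} sqrt"
proof (induction k)
  case 0
  then show ?case by (auto intro!: continuous_intros)
next
  case (Suc k)
  show ?case
  proof (rule Ck_on_SucI[OF open_greaterThan])
    show "(sqrt has_derivative (\<lambda>v. v * (inverse (sqrt x) / 2))) (at x)" if "x \<in> {0<..}" for x
    proof -
      have "(sqrt has_derivative (*) (inverse (sqrt x) / 2)) (at x)"
        using DERIV_real_sqrt[of x] that by (simp add: has_field_derivative_def)
      then show ?thesis
        by (rule has_derivative_eq_rhs) (simp add: fun_eq_iff)
    qed
    \<comment> \<open>The derivative of the root involves only its reciprocal, which has order k by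
      the induction hypothesis and composition with \<open>inverse\<close>.\<close>
    have "Ck_on k {0<..} (\<lambda>x. inverse (sqrt x))"
      by (rule Ck_on_compose[OF _ _ _ Suc Ck_on_inverse]) (auto simp: open_Collect_neq)
    then show "Ck_on k {0<..} (\<lambda>x. v * (inverse (sqrt x) / 2))" for v
      by (intro Ck_on_linear_compose[OF _ bounded_linear_mult_right]
          Ck_on_linear_compose[OF _ bounded_linear_divide]) auto
  qed
qed

lemma smooth_on_cong:
  "open S \<Longrightarrow> (\<And>x. x \<in> S \<Longrightarrow> f x = g x) \<Longrightarrow> smooth_on S f \<Longrightarrow> smooth_on S g"
  unfolding smooth_on_def using Ck_on_cong by blast

lemma smooth_on_const: "open S \<Longrightarrow> smooth_on S (\<lambda>x. c)"
  unfolding smooth_on_def using Ck_on_const by blast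

lemma smooth_on_bounded_linear: "open S \<Longrightarrow> bounded_linear L \<Longrightarrow> smooth_on S L"
  unfolding smooth_on_def using Ck_on_bounded_linear by blast

lemma smooth_on_add:
  "open S \<Longrightarrow> smooth_on S f \<Longrightarrow> smooth_on S g \<Longrightarrow> smooth_on S (\<lambda>x. f x + g x)"
  unfolding smooth_on_def using Ck_on_add by blast

lemma smooth_on_linear_compose:
  "open S \<Longrightarrow> bounded_linear L \<Longrightarrow> smooth_on S f \<Longrightarrow> smooth_on S (\<lambda>x. L (f x))"
  unfolding smooth_on_def using Ck_on_linear_compose by blast

lemma smooth_on_uminus: "open S \<Longrightarrow> smooth_on S f \<Longrightarrow> smooth_on S (\<lambda>x. - f x)"
  by (rule smooth_on_linear_compose[OF _ bounded_linear_minus[OF bounded_linear_ident]])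

lemma smooth_on_diff:
  "open S \<Longrightarrow> smooth_on S f \<Longrightarrow> smooth_on S g \<Longrightarrow> smooth_on S (\<lambda>x. f x - g x)"
  using smooth_on_add[of S f "\<lambda>x. - g x"] smooth_on_uminus[of S g] by simp

lemma smooth_on_Pair:
  assumes "open S" "smooth_on S f" "smooth_on S g"
  shows "smooth_on S (\<lambda>x. (f x, g x))"
proof -
  have "smooth_on S (\<lambda>x. (f x, 0) + (0, g x))"
  proof (rule smooth_on_add[OF assms(1)])
    have "bounded_linear (\<lambda>y. (y, 0))" "bounded_linear (\<lambda>y. (0, y))"
      by (rule bounded_linear_Pair[OF bounded_linear_ident bounded_linear_zero]
          bounded_linear_Pair[OF bounded_linear_zero bounded_linear_ident])+
    from smooth_on_linear_compose[OF assms(1) this(1) assms(2)]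
      smooth_on_linear_compose[OF assms(1) this(2) assms(3)]
    show "smooth_on S (\<lambda>x. (f x, 0))" "smooth_on S (\<lambda>x. (0, g x))"
      by simp_all
  qed
  then show ?thesis by simp
qed

lemma smooth_on_mult:
  fixes f g :: "_ \<Rightarrow> real"
  shows "open S \<Longrightarrow> smooth_on S f \<Longrightarrow> smooth_on S g \<Longrightarrow> smooth_on S (\<lambda>x. f x * g x)"
  unfolding smooth_on_def using Ck_on_bounded_bilinear[OF bounded_bilinear_mult] by blast

lemma smooth_on_scaleR:
  "open S \<Longrightarrow> smooth_on S f \<Longrightarrow> smooth_on S g \<Longrightarrow> smooth_on S (\<lambda>x. f x *\<^sub>R g x)"
  unfolding smooth_on_def using Ck_on_bounded_bilinear[OF bounded_bilinear_scaleR] by blast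

lemma smooth_on_sum:
  "open S \<Longrightarrow> (\<And>i. i \<in> I \<Longrightarrow> smooth_on S (f i)) \<Longrightarrow> smooth_on S (\<lambda>x. \<Sum>i\<in>I. f i x)"
  unfolding smooth_on_def by (auto intro: Ck_on_sum)

lemma smooth_on_prod:
  fixes f :: "_ \<Rightarrow> _ \<Rightarrow> real"
  assumes "open S" "\<And>i. i \<in> I \<Longrightarrow> smooth_on S (f i)"
  shows "smooth_on S (\<lambda>x. \<Prod>i\<in>I. f i x)"
  using assms(2)
  by (induction I rule: infinite_finite_induct) (auto intro!: smooth_on_const smooth_on_mult assms(1))

lemma smooth_on_compose:
  fixes f :: "'d::euclidean_space \<Rightarrow> 'e::euclidean_space"
  assumes "open S" "open T" "f ` S \<subseteq> T" "smooth_on S f" "smooth_on T g"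
  shows "smooth_on S (\<lambda>x. g (f x))"
  using assms(4,5) unfolding smooth_on_def by (auto intro: Ck_on_compose[OF assms(1-3), of _ g])

lemma smooth_on_divide:
  fixes f g :: "_ \<Rightarrow> real"
  assumes "open S" "\<And>x. x \<in> S \<Longrightarrow> g x \<noteq> 0" "smooth_on S f" "smooth_on S g"
  shows "smooth_on S (\<lambda>x. f x / g x)"
proof -
  have "smooth_on S (\<lambda>x. inverse (g x))"
    by (rule smooth_on_compose[of S "{x. x \<noteq> 0}" g])
      (use assms in \<open>auto simp: open_Collect_neq smooth_on_def Ck_on_inverse\<close>)
  then show ?thesis
    using assms by (simp add: divide_inverse smooth_on_mult)
qed

lemma smooth_on_sqrt:
  assumes "open S" "\<And>x. x \<in> S \<Longrightarrow> f x > 0" "smooth_on S f"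
  shows "smooth_on S (\<lambda>x. sqrt (f x))"
  by (rule smooth_on_compose[of S "{0<..}" f]) (use assms in \<open>auto simp: smooth_on_def Ck_on_sqrt\<close>)

lemma smooth_on_imp_has_derivative:
  assumes "open S" "smooth_on S f" "x \<in> S"
  shows "(f has_derivative frechet_derivative f (at x)) (at x)"
  using assms Ck_on_Suc_imp_has_derivative[of S 0 f x] unfolding smooth_on_def by blast

lemma smooth_on_imp_continuous_on: "smooth_on S f \<Longrightarrow> continuous_on S f"
  unfolding smooth_on_def using Ck_on.simps(1) by blast

lemma smooth_on_frechet_derivative:
  "smooth_on S f \<Longrightarrow> smooth_on S (\<lambda>x. frechet_derivative f (at x) v)"
  unfolding smooth_on_def by (metis Ck_on.simps(2))

lemma linear_frechet_derivative_smooth_on: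
  "open S \<Longrightarrow> smooth_on S f \<Longrightarrow> x \<in> S \<Longrightarrow> linear (frechet_derivative f (at x))"
  using smooth_on_imp_has_derivative has_derivative_linear by blast

text \<open>Joint smoothness in the base point and the vector. This is what the fibre component of a
  transition map between induced charts requires.\<close>

lemma smooth_on_frechet_derivative_apply:
  assumes "open S" "open T" "f ` T \<subseteq> S" "smooth_on S F" "smooth_on T f" "smooth_on T w"
  shows "smooth_on T (\<lambda>x. frechet_derivative F (at (f x)) (w x))"
proof (rule smooth_on_cong[OF assms(2)])
  show "(\<Sum>b\<in>Basis. (w x \<bullet> b) *\<^sub>R frechet_derivative F (at (f x)) b)
      = frechet_derivative F (at (f x)) (w x)" if "x \<in> T" for x
    using that assms(3)
    by (intro linear_eq_sum_Basis[symmetric] linear_frechet_derivative_smooth_on[OF assms(1,4)]) auto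
  show "smooth_on T (\<lambda>x. \<Sum>b\<in>Basis. (w x \<bullet> b) *\<^sub>R frechet_derivative F (at (f x)) b)"
    using assms
    by (intro smooth_on_sum smooth_on_scaleR smooth_on_linear_compose[OF _ bounded_linear_inner_left]
        smooth_on_compose[of T S f "\<lambda>y. frechet_derivative F (at y) _"]
        smooth_on_frechet_derivative)
qed

lemma smooth_on_vec_nth: "open S \<Longrightarrow> smooth_on S f \<Longrightarrow> smooth_on S (\<lambda>x. f x $ i)"
  by (rule smooth_on_linear_compose[OF _ bounded_linear_vec_nth])

lemma smooth_on_vec_lambda:
  fixes f :: "'n::finite \<Rightarrow> _ \<Rightarrow> real"
  assumes "open S" "\<And>i. smooth_on S (f i)"
  shows "smooth_on S (\<lambda>x. \<chi> i. f i x)"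
proof -
  have "(\<chi> i. f i x) = (\<Sum>i\<in>UNIV. f i x *\<^sub>R axis i 1)" for x
    by (simp add: vec_eq_iff axis_def if_distrib[of "(*) _"] cong: if_cong)
  then show ?thesis
    using assms by (simp only:) (intro smooth_on_sum smooth_on_scaleR smooth_on_const)
qed

lemma smooth_on_det:
  fixes M :: "_ \<Rightarrow> real ^ 'n ^ 'n"
  assumes "open S" "\<And>i j. smooth_on S (\<lambda>x. M x $ i $ j)"
  shows "smooth_on S (\<lambda>x. det (M x))"
  unfolding det_def using assms
  by (intro smooth_on_sum smooth_on_mult smooth_on_prod smooth_on_const)

lemma matrix_inv_right: "invertible M \<Longrightarrow> M ** matrix_inv M = mat 1"
  unfolding invertible_def matrix_inv_def by (rule someI2_ex) auto

text \<open>Cramer's rule: column l of the inverse solves M z = e_l, so its entry k is the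
  determinant of M with column k replaced by e_l, divided by det M. Determinants are polynomials in
  the entries.\<close>

lemma smooth_on_matrix_inv_nth:
  fixes M :: "_ \<Rightarrow> real ^ 'n ^ 'n"
  assumes "open S" "\<And>i j. smooth_on S (\<lambda>x. M x $ i $ j)" "\<And>x. x \<in> S \<Longrightarrow> invertible (M x)"
  shows "smooth_on S (\<lambda>x. matrix_inv (M x) $ k $ l)"
proof (rule smooth_on_cong[OF assms(1)])
  let ?C = "\<lambda>x. \<chi> i j. if j = k then axis l 1 $ i else M x $ i $ j"
  show "det (?C x) / det (M x) = matrix_inv (M x) $ k $ l" if "x \<in> S" for x
  proof -
    have nz: "det (M x) \<noteq> 0"
      using assms(3)[OF that] by (simp add: invertible_det_nz)
    have "M x *v (matrix_inv (M x) *v axis l 1) = axis l 1"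
      using matrix_inv_right[OF assms(3)[OF that]] by (simp add: matrix_vector_mul_assoc)
    from arg_cong[OF iffD1[OF cramer[OF nz] this], of "\<lambda>v. v $ k"]
    show ?thesis
      by (simp add: matrix_vector_mult_basis column_def)
  qed
  have "smooth_on S (\<lambda>x. ?C x $ i $ j)" for i j
    using assms(1,2) by (cases "j = k") (simp_all add: smooth_on_const)
  then show "smooth_on S (\<lambda>x. det (?C x) / det (M x))"
    using assms by (intro smooth_on_divide smooth_on_det) (auto simp: invertible_det_nz)
qed

section \<open>Symmetry of the second derivative\<close>

lemma DERIV_along_line:
  fixes F :: "'e::real_normed_vector \<Rightarrow> real"
  assumes "(F has_derivative L) (at (p + s *\<^sub>R a))"
  shows "((\<lambda>s. F (p + s *\<^sub>R a)) has_real_derivative L a) (at s)"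
proof -
  have "((\<lambda>s. p + s *\<^sub>R a) has_derivative (\<lambda>h. h *\<^sub>R a)) (at s)"
    by (auto intro!: derivative_eq_intros)
  from has_derivative_compose[OF this assms]
  show ?thesis
    using linear_scale[OF has_derivative_linear[OF assms]]
    by (simp add: has_field_derivative_def mult_commute_abs)
qed

text \<open>Two applications of the mean value theorem. The left-hand side is symmetric in \<open>a\<close> and
  \<open>b\<close>, whence the symmetry of the second derivative as \<open>h \<rightarrow> 0\<close>.\<close>

lemma double_difference_mean_value:
  fixes f :: "'e::euclidean_space \<Rightarrow> real"
  assumes S: "open S" "smooth_on S f" and h: "h > 0"
    and sub: "cball x (h * (norm a + norm b)) \<subseteq> S"
  shows "\<exists>y. dist x y \<le> h * (norm a + norm b) \<and>
    f (x + h *\<^sub>R a + h *\<^sub>R b) - f (x + h *\<^sub>R a) - f (x + h *\<^sub>R b) + f x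
    = h * h * frechet_derivative (\<lambda>x. frechet_derivative f (at x) a) (at y) b"
proof -
  \<comment> \<open>Every point at which f or one of its derivatives is evaluated lies in the
    parallelogram spanned by \<open>h *\<^sub>R a\<close> and \<open>h *\<^sub>R b\<close> at x,
    hence in the ball contained in S.\<close>
  have near: "dist x (x + s *\<^sub>R a + t *\<^sub>R b) \<le> h * (norm a + norm b)"
    if "0 \<le> s" "s \<le> h" "0 \<le> t" "t \<le> h" for s t
  proof -
    have "dist x (x + s *\<^sub>R a + t *\<^sub>R b) = norm (s *\<^sub>R a + t *\<^sub>R b)"
      by (metis add.assoc add_diff_cancel_left' dist_commute dist_norm)
    also have "\<dots> \<le> s * norm a + t * norm b"
      using norm_triangle_ineq[of "s *\<^sub>R a" "t *\<^sub>R b"] that by simp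
    also have "\<dots> \<le> h * (norm a + norm b)"
      using that by (simp add: distrib_left add_mono mult_right_mono)
    finally show ?thesis .
  qed
  have inS: "x + s *\<^sub>R a + t *\<^sub>R b \<in> S" if "0 \<le> s" "s \<le> h" "0 \<le> t" "t \<le> h" for s t
    using near[OF that] sub by auto
  let ?D = "\<lambda>x. frechet_derivative f (at x) a"
  \<comment> \<open>The double difference is the increment over [0, h] of the difference of f along
    two parallel lines in direction a.\<close>
  have "\<exists>\<xi>>0. \<xi> < h \<and> (f (x + h *\<^sub>R b + h *\<^sub>R a) - f (x + h *\<^sub>R a))
      - (f (x + h *\<^sub>R b + 0 *\<^sub>R a) - f (x + 0 *\<^sub>R a))
      = (h - 0) * (?D (x + h *\<^sub>R b + \<xi> *\<^sub>R a) - ?D (x + \<xi> *\<^sub>R a))"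
  proof (rule MVT2[OF h])
    fix s :: real assume s: "0 \<le> s" "s \<le> h"
    have "x + h *\<^sub>R b + s *\<^sub>R a \<in> S" "x + s *\<^sub>R a \<in> S"
      using inS[OF s, of h] inS[OF s, of 0] h by (simp_all add: add_ac)
    then show "((\<lambda>s. f (x + h *\<^sub>R b + s *\<^sub>R a) - f (x + s *\<^sub>R a)) has_real_derivative
        ?D (x + h *\<^sub>R b + s *\<^sub>R a) - ?D (x + s *\<^sub>R a)) (at s)"
      by (intro DERIV_diff DERIV_along_line smooth_on_imp_has_derivative[OF S])
  qed
  then obtain \<xi> where xi: "0 < \<xi>" "\<xi> < h"
    and eq1: "f (x + h *\<^sub>R a + h *\<^sub>R b) - f (x + h *\<^sub>R a) - f (x + h *\<^sub>R b) + f x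
      = h * (?D (x + \<xi> *\<^sub>R a + h *\<^sub>R b) - ?D (x + \<xi> *\<^sub>R a + 0 *\<^sub>R b))"
    by (auto simp: add_ac)
  \<comment> \<open>The remaining difference of derivatives along a is an increment in direction
    b.\<close>
  have "\<exists>\<eta>>0. \<eta> < h \<and> ?D (x + \<xi> *\<^sub>R a + h *\<^sub>R b) - ?D (x + \<xi> *\<^sub>R a + 0 *\<^sub>R b)
      = (h - 0) * frechet_derivative ?D (at (x + \<xi> *\<^sub>R a + \<eta> *\<^sub>R b)) b"
  proof (rule MVT2[OF h])
    fix t :: real assume "0 \<le> t" "t \<le> h"
    then show "((\<lambda>t. ?D (x + \<xi> *\<^sub>R a + t *\<^sub>R b)) has_real_derivative
        frechet_derivative ?D (at (x + \<xi> *\<^sub>R a + t *\<^sub>R b)) b) (at t)"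
      using xi inS
      by (intro DERIV_along_line smooth_on_imp_has_derivative[OF S(1)]
          smooth_on_frechet_derivative[OF S(2)]) auto
  qed
  then obtain \<eta> where eta: "0 < \<eta>" "\<eta> < h"
    and eq2: "?D (x + \<xi> *\<^sub>R a + h *\<^sub>R b) - ?D (x + \<xi> *\<^sub>R a + 0 *\<^sub>R b)
      = h * frechet_derivative ?D (at (x + \<xi> *\<^sub>R a + \<eta> *\<^sub>R b)) b"
    by auto
  show ?thesis
    using near[of \<xi> \<eta>] xi eta unfolding eq1 eq2 by (intro exI[of _ "x + \<xi> *\<^sub>R a + \<eta> *\<^sub>R b"]) auto
qed

text \<open>If the two mixed derivatives differed at x, continuity would keep them apart on a small
  ball, each within half of the gap of its value at x. But one double difference is h^2 times either
  of them, at two points of that ball.\<close>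

lemma second_derivative_symmetric_real:
  fixes f :: "'e::euclidean_space \<Rightarrow> real"
  assumes S: "open S" "smooth_on S f" and x: "x \<in> S"
  shows "frechet_derivative (\<lambda>x. frechet_derivative f (at x) a) (at x) b
    = frechet_derivative (\<lambda>x. frechet_derivative f (at x) b) (at x) a"
proof (rule ccontr)
  define P where "P a b y = frechet_derivative (\<lambda>x. frechet_derivative f (at x) a) (at y) b" for a b y
  assume "\<not> ?thesis"
  then have ne: "P a b x \<noteq> P b a x" by (simp add: P_def)
  have "isCont (P a b) x" for a b
    using smooth_on_imp_continuous_on[OF smooth_on_frechet_derivative[OF smooth_on_frechet_derivative[OF S(2)]]]
      S(1) x unfolding P_def by (auto simp: continuous_on_eq_continuous_at)
  then have "isCont (\<lambda>y. P a b y) x" "isCont (\<lambda>y. P b a y) x" by auto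
  moreover define e where "e = \<bar>P a b x - P b a x\<bar> / 2"
  moreover have "e > 0" using ne by (simp add: e_def)
  ultimately obtain d1 d2 where d1: "d1 > 0" "\<And>y. dist y x < d1 \<Longrightarrow> dist (P a b y) (P a b x) < e"
    and d2: "d2 > 0" "\<And>y. dist y x < d2 \<Longrightarrow> dist (P b a y) (P b a x) < e"
    unfolding continuous_at_eps_delta by metis
  obtain d3 where d3: "d3 > 0" "cball x d3 \<subseteq> S"
    using S(1) x open_contains_cball by metis
  define d where "d = min d3 (min d1 d2) / 2"
  have d: "d > 0" "d < d1" "d < d2" "d \<le> d3"
    using d1(1) d2(1) d3(1) by (auto simp: d_def min_def)
  \<comment> \<open>The summand 1 keeps the denominator positive when a and b are both zero.\<close>
  define h where "h = d / (norm a + norm b + 1)"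
  have h: "h > 0" unfolding h_def using d(1) by (intro divide_pos_pos add_nonneg_pos) auto
  have "h * (norm a + norm b) \<le> h * (norm a + norm b + 1)"
    using h by simp
  also have "\<dots> = d"
    using add_nonneg_pos[of "norm a + norm b" 1] by (simp add: h_def)
  finally have hd: "h * (norm a + norm b) \<le> d" .
  have "cball x (h * (norm a + norm b)) \<subseteq> S" "cball x (h * (norm b + norm a)) \<subseteq> S"
    using hd d(4) d3(2) by (force simp: add.commute)+
  from double_difference_mean_value[OF S h this(1)] double_difference_mean_value[OF S h this(2)]
  obtain y z where y: "dist x y \<le> d" "dist x z \<le> d"
    and "f (x + h *\<^sub>R a + h *\<^sub>R b) - f (x + h *\<^sub>R a) - f (x + h *\<^sub>R b) + f x = h * h * P a b y"
    and "f (x + h *\<^sub>R b + h *\<^sub>R a) - f (x + h *\<^sub>R b) - f (x + h *\<^sub>R a) + f x = h * h * P b a z"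
    using hd unfolding P_def[symmetric] add.commute[of "norm b"] by (meson order_trans)
  then have "h * h * P a b y = h * h * P b a z"
    unfolding add.assoc add.commute[of "h *\<^sub>R b" "h *\<^sub>R a"] by linarith
  then have "P a b y = P b a z" using h by simp
  moreover have "dist (P a b y) (P a b x) < e" "dist (P b a z) (P b a x) < e"
    using y d d1(2)[of y] d2(2)[of z] by (simp_all add: dist_commute)
  ultimately show False
    by (auto simp: e_def dist_real_def abs_if split: if_splits)
qed

lemma second_derivative_symmetric:
  fixes f :: "'e::euclidean_space \<Rightarrow> 'b::euclidean_space"
  assumes S: "open S" "smooth_on S f" and x: "x \<in> S"
  shows "frechet_derivative (\<lambda>x. frechet_derivative f (at x) a) (at x) b
    = frechet_derivative (\<lambda>x. frechet_derivative f (at x) b) (at x) a"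
proof (rule euclidean_eqI)
  fix i :: 'b
  have inner: "frechet_derivative (\<lambda>x. F x \<bullet> i) (at y) v = frechet_derivative F (at y) v \<bullet> i"
    if "smooth_on S F" "y \<in> S" for F y v
    using frechet_derivative_at[OF bounded_linear.has_derivative[OF bounded_linear_inner_left
        smooth_on_imp_has_derivative[OF S(1) that]], of i] by metis
  have "frechet_derivative (\<lambda>x. frechet_derivative f (at x) a) (at x) b \<bullet> i
      = frechet_derivative (\<lambda>x. frechet_derivative (\<lambda>x. f x \<bullet> i) (at x) a) (at x) b" for a b
    unfolding inner[OF smooth_on_frechet_derivative[OF S(2)] x, symmetric]
    by (intro fun_cong[OF frechet_derivative_cong_open[OF S(1) x]]) (simp add: inner[OF S(2)])
  moreover have "smooth_on S (\<lambda>x. f x \<bullet> i)"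
    using S by (intro smooth_on_linear_compose[OF _ bounded_linear_inner_left])
  ultimately show "frechet_derivative (\<lambda>x. frechet_derivative f (at x) a) (at x) b \<bullet> i
      = frechet_derivative (\<lambda>x. frechet_derivative f (at x) b) (at x) a \<bullet> i"
    using second_derivative_symmetric_real[OF S(1) _ x] by simp
qed

section \<open>Tangent spaces and the manifold topology\<close>

text \<open>The Jacobian DF of a change of charts. It is indexed by the point p of the manifold
  rather than by coordinates, so that the laws for several charts refer to one common point.\<close>

definition transition_deriv :: "('a, 'e::euclidean_space) chart \<Rightarrow> ('a, 'e) chart \<Rightarrow> 'a \<Rightarrow> 'e \<Rightarrow> 'e" where
  "transition_deriv c d p = frechet_derivative (transition c d) (at (snd c p))"

lemma chart_inv_into: "x \<in> chart_image c \<Longrightarrow> chart_inv c x \<in> fst c"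
  unfolding chart_image_def chart_inv_def by (rule inv_into_into)

lemma snd_chart_inv: "x \<in> chart_image c \<Longrightarrow> snd c (chart_inv c x) = x"
  unfolding chart_image_def chart_inv_def by (rule f_inv_into_f)

lemma chart_imageI: "p \<in> fst c \<Longrightarrow> snd c p \<in> chart_image c"
  by (simp add: chart_image_def)

lemma charts_at_iff: "c \<in> charts_at A p \<longleftrightarrow> c \<in> A \<and> p \<in> fst c"
  by (simp add: charts_at_def)

lemma carrier_iff: "p \<in> carrier A \<longleftrightarrow> (\<exists>c. c \<in> charts_at A p)"
  by (simp add: carrier_def charts_at_def Bex_def)

lemma charts_at_imp_carrier: "c \<in> charts_at A p \<Longrightarrow> p \<in> carrier A"
  by (auto simp: carrier_def charts_at_def)

context
  fixes A :: "('a, 'e::euclidean_space) atlas"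
  assumes atlas: "smooth_atlas A"
begin

lemma inj_on_chart: "c \<in> A \<Longrightarrow> inj_on (snd c) (fst c)"
  using atlas by (simp add: smooth_atlas_def)

lemma open_chart_image: "c \<in> A \<Longrightarrow> open (chart_image c)"
  using atlas by (simp add: smooth_atlas_def)

lemma open_overlap: "c \<in> A \<Longrightarrow> d \<in> A \<Longrightarrow> open (snd c ` (fst c \<inter> fst d))"
  using atlas by (simp add: smooth_atlas_def)

lemma smooth_transition:
  "c \<in> A \<Longrightarrow> d \<in> A \<Longrightarrow> smooth_on (snd c ` (fst c \<inter> fst d)) (transition c d)"
  using atlas by (simp add: smooth_atlas_def)

lemma chart_inv_snd: "c \<in> charts_at A p \<Longrightarrow> chart_inv c (snd c p) = p"
  unfolding chart_inv_def charts_at_iff by (auto intro: inv_into_f_f inj_on_chart)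

lemma transition_snd: "c \<in> charts_at A p \<Longrightarrow> transition c d (snd c p) = snd d p"
  by (simp add: transition_def chart_inv_snd)

lemma has_derivative_transition:
  assumes "c \<in> charts_at A p" "d \<in> charts_at A p"
  shows "(transition c d has_derivative transition_deriv c d p) (at (snd c p))"
  unfolding transition_deriv_def using assms
  by (intro smooth_on_imp_has_derivative[OF open_overlap smooth_transition]) (auto simp: charts_at_iff)

lemma linear_transition_deriv:
  "c \<in> charts_at A p \<Longrightarrow> d \<in> charts_at A p \<Longrightarrow> linear (transition_deriv c d p)"
  using has_derivative_transition has_derivative_linear by blast

lemma transition_deriv_compose:
  assumes "c \<in> charts_at A p" "d \<in> charts_at A p" "e \<in> charts_at A p"
  shows "transition_deriv d e p (transition_deriv c d p v) = transition_deriv c e p v"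
proof -
  let ?S = "snd c ` (fst c \<inter> fst d)"
  have S: "open ?S" "snd c p \<in> ?S"
    using assms by (auto simp: charts_at_iff open_overlap)
  \<comment> \<open>Both sides evaluate to \<open>snd e q\<close>, so the maps agree on the whole
    overlap of c and d, an open set around \<open>snd c p\<close> on which derivatives may be
    compared.\<close>
  have eq: "transition d e (transition c d x) = transition c e x" if "x \<in> ?S" for x
  proof -
    obtain q where "q \<in> fst c" "q \<in> fst d" "x = snd c q" using \<open>x \<in> ?S\<close> by blast
    then show ?thesis
      using assms by (simp add: charts_at_iff transition_snd)
  qed
  have "(transition d e has_derivative transition_deriv d e p) (at (transition c d (snd c p)))"
    using has_derivative_transition[OF assms(2,3)] transition_snd[OF assms(1)] by simp
  from has_derivative_compose[OF has_derivative_transition[OF assms(1,2)] this]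
  have "(transition c e has_derivative (\<lambda>v. transition_deriv d e p (transition_deriv c d p v))) (at (snd c p))"
    by (rule has_derivative_transform_within_open[OF _ S eq])
  then have "(\<lambda>v. transition_deriv d e p (transition_deriv c d p v)) = transition_deriv c e p"
    using has_derivative_transition[OF assms(1,3)] has_derivative_unique by blast
  then show ?thesis by metis
qed

lemma transition_deriv_self:
  assumes "c \<in> charts_at A p"
  shows "transition_deriv c c p v = v"
proof -
  have "transition c c x = x" if "x \<in> chart_image c" for x
    using that by (simp add: transition_def snd_chart_inv)
  then have "frechet_derivative (transition c c) (at (snd c p)) = frechet_derivative (\<lambda>x. x) (at (snd c p))"
    using assms by (intro frechet_derivative_cong_open[of "chart_image c"])
      (auto simp: charts_at_iff open_chart_image intro: chart_imageI)
  then show ?thesis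
    by (simp add: transition_deriv_def)
qed

lemma transition_deriv_inverse:
  "c \<in> charts_at A p \<Longrightarrow> d \<in> charts_at A p \<Longrightarrow>
    transition_deriv d c p (transition_deriv c d p v) = v"
  by (simp add: transition_deriv_compose transition_deriv_self)

lemma tangent_space_iff:
  "v \<in> tangent_space A p \<longleftrightarrow>
    (\<forall>c\<in>charts_at A p. \<forall>d\<in>charts_at A p. v d = transition_deriv c d p (v c)) \<and>
    (\<forall>c. c \<notin> charts_at A p \<longrightarrow> v c = 0)"
  by (simp add: tangent_space_def transition_deriv_def)

lemma tangent_space_transition:
  "v \<in> tangent_space A p \<Longrightarrow> c \<in> charts_at A p \<Longrightarrow> d \<in> charts_at A p \<Longrightarrow>
    transition_deriv c d p (v c) = v d"
  unfolding tangent_space_iff by metis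

lemma tangent_space_outside: "v \<in> tangent_space A p \<Longrightarrow> c \<notin> charts_at A p \<Longrightarrow> v c = 0"
  unfolding tangent_space_iff by blast

lemma coord_vector_apply:
  "coord_vector A c p e d = (if d \<in> charts_at A p then transition_deriv c d p e else 0)"
  by (simp add: coord_vector_def transition_deriv_def)

lemma coord_vector_in_tangent_space:
  "c \<in> charts_at A p \<Longrightarrow> coord_vector A c p e \<in> tangent_space A p"
  by (simp add: tangent_space_iff coord_vector_apply transition_deriv_compose)

lemma coord_vector_self: "c \<in> charts_at A p \<Longrightarrow> coord_vector A c p e c = e"
  by (simp add: coord_vector_apply transition_deriv_self)

text \<open>Together with \<open>coord_vector_self\<close>, this makes evaluation at c a bijection
  from the tangent space onto the model space. Identities of tangent vectors can therefore be
  checked in one chart.\<close>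

lemma coord_vector_eq:
  "c \<in> charts_at A p \<Longrightarrow> v \<in> tangent_space A p \<Longrightarrow> coord_vector A c p (v c) = v"
  by (rule ext) (simp add: coord_vector_apply tangent_space_transition tangent_space_outside)

lemma coord_vector_transition:
  "c \<in> charts_at A p \<Longrightarrow> d \<in> charts_at A p \<Longrightarrow>
    coord_vector A d p (transition_deriv c d p e) = coord_vector A c p e"
  by (auto simp: coord_vector_apply transition_deriv_compose)

lemma coord_vector_linear:
  assumes "c \<in> charts_at A p"
  shows "coord_vector A c p (r *\<^sub>R e + s *\<^sub>R e')
    = (\<lambda>d. r *\<^sub>R coord_vector A c p e d + s *\<^sub>R coord_vector A c p e' d)"
proof
  fix d
  show "coord_vector A c p (r *\<^sub>R e + s *\<^sub>R e') d
    = r *\<^sub>R coord_vector A c p e d + s *\<^sub>R coord_vector A c p e' d"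
    using linear_add[OF linear_transition_deriv[OF assms]] linear_scale[OF linear_transition_deriv[OF assms]]
    by (simp add: coord_vector_apply)
qed

lemma tangent_space_combination:
  assumes "v \<in> tangent_space A p" "w \<in> tangent_space A p"
  shows "(\<lambda>c. r *\<^sub>R v c + s *\<^sub>R w c) \<in> tangent_space A p"
  unfolding tangent_space_iff
proof (intro conjI ballI allI impI)
  fix c d assume c: "c \<in> charts_at A p" and d: "d \<in> charts_at A p"
  show "r *\<^sub>R v d + s *\<^sub>R w d = transition_deriv c d p (r *\<^sub>R v c + s *\<^sub>R w c)"
    by (simp add: linear_add[OF linear_transition_deriv[OF c d]] assms c d
        linear_scale[OF linear_transition_deriv[OF c d]] tangent_space_transition)
qed (use assms in \<open>simp add: tangent_space_outside\<close>)

lemma tangent_vector_eqI: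
  "c \<in> charts_at A p \<Longrightarrow> v \<in> tangent_space A p \<Longrightarrow> w \<in> tangent_space A p \<Longrightarrow> v c = w c \<Longrightarrow> v = w"
  by (metis coord_vector_eq)

lemma tangent_vector_eq_0_iff:
  assumes "c \<in> charts_at A p" "v \<in> tangent_space A p"
  shows "v = (\<lambda>_. 0) \<longleftrightarrow> v c = 0"
proof -
  have "(\<lambda>_. 0) \<in> tangent_space A p"
    using tangent_space_combination[OF assms(2,2), of 0 0] by simp
  then show ?thesis using assms tangent_vector_eqI by fastforce
qed

lemma coord_vector_eq_0_iff:
  "c \<in> charts_at A p \<Longrightarrow> coord_vector A c p e = (\<lambda>_. 0) \<longleftrightarrow> e = 0"
  by (simp add: tangent_vector_eq_0_iff coord_vector_in_tangent_space coord_vector_self)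

section \<open>The topology generated by the charts\<close>

lemma openin_chart_preimage:
  "c \<in> A \<Longrightarrow> open S \<Longrightarrow> openin (manifold_topology A) (fst c \<inter> snd c -` S)"
  unfolding manifold_topology_def by (intro topology_generated_by_Basis) blast

text \<open>Induction over the generation of the topology. Intersections need injectivity of the
  chart; the image of a generator of another chart d is the preimage of an open set under the
  continuous transition map.\<close>

lemma open_image_openin:
  assumes "openin (manifold_topology A) U" "c \<in> A"
  shows "open (snd c ` (U \<inter> fst c))"
proof -
  have "generate_topology_on {fst c \<inter> snd c -` S | c S. c \<in> A \<and> open S} U"
    using assms(1) by (simp add: manifold_topology_def openin_topology_generated_by_iff)
  then show ?thesis
  proof induction
    case Empty
    then show ?case by simp
  next
    case (Int U V)
    have "snd c ` (U \<inter> V \<inter> fst c) = snd c ` (U \<inter> fst c) \<inter> snd c ` (V \<inter> fst c)"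
      using inj_on_image_Int[OF inj_on_chart[OF assms(2)], of "U \<inter> fst c" "V \<inter> fst c"]
      by (simp add: Int_ac)
    then show ?case using Int by auto
  next
    case (UN K)
    have "snd c ` (\<Union>K \<inter> fst c) = (\<Union>U\<in>K. snd c ` (U \<inter> fst c))" by blast
    then show ?case using UN by auto
  next
    case (Basis U)
    then obtain d S where d: "d \<in> A" "open S" "U = fst d \<inter> snd d -` S" by blast
    have "snd c ` (U \<inter> fst c) = snd c ` (fst c \<inter> fst d) \<inter> transition c d -` S"
      using assms(2) unfolding d(3)
      by (auto simp: transition_snd charts_at_iff intro!: imageI)
    then show ?case
      using continuous_open_preimage[OF smooth_on_imp_continuous_on[OF smooth_transition] open_overlap d(2)]
        assms(2) d(1) by simp
  qed
qed

lemma openin_chart_domain: "c \<in> A \<Longrightarrow> openin (manifold_topology A) (fst c)"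
  using openin_chart_preimage[of c UNIV] by simp

lemma topspace_manifold_topology: "topspace (manifold_topology A) = carrier A"
proof -
  have "\<Union>{fst c \<inter> snd c -` S | c S. c \<in> A \<and> open S} = carrier A"
  proof (rule subset_antisym)
    show "\<Union>{fst c \<inter> snd c -` S | c S. c \<in> A \<and> open S} \<subseteq> carrier A"
      by (auto simp: carrier_def)
    have "fst c \<in> {fst c \<inter> snd c -` S | c S. c \<in> A \<and> open S}" if "c \<in> A" for c
      using that by (intro CollectI exI[of _ c] exI[of _ UNIV]) simp
    then show "carrier A \<subseteq> \<Union>{fst c \<inter> snd c -` S | c S. c \<in> A \<and> open S}"
      unfolding carrier_def by (intro UN_least Union_upper)
  qed
  then show ?thesis
    by (simp add: manifold_topology_def)
qed

text \<open>The converse of \<open>open_image_openin\<close>. By injectivity, the part of U in a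
  chart domain is the preimage of its own coordinate image, hence a generating set, and U is the
  union of these parts.\<close>

lemma openin_manifold_topologyI:
  assumes "U \<subseteq> carrier A" "\<And>c. c \<in> A \<Longrightarrow> open (snd c ` (U \<inter> fst c))"
  shows "openin (manifold_topology A) U"
proof -
  have "U \<inter> fst c = fst c \<inter> snd c -` (snd c ` (U \<inter> fst c))" if "c \<in> A" for c
    using inj_on_image_mem_iff[OF inj_on_chart[OF that], of _ "U \<inter> fst c"] by auto
  then have "openin (manifold_topology A) (U \<inter> fst c)" if "c \<in> A" for c
    using openin_chart_preimage[OF that assms(2)[OF that]] that by simp
  then have "openin (manifold_topology A) (\<Union>c\<in>A. U \<inter> fst c)"
    by (intro openin_Union) blast
  moreover have "U = (\<Union>c\<in>A. U \<inter> fst c)"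
    using assms(1) by (auto simp: carrier_def)
  ultimately show ?thesis by simp
qed

text \<open>Those members of a countable base that fit into a chart domain already cover the
  carrier; choosing one chart for each leaves countably many. This gives second countability
  upstairs.\<close>

lemma countable_chart_cover:
  assumes "second_countable (manifold_topology A)"
  obtains C where "countable C" "C \<subseteq> A" "\<And>p. p \<in> carrier A \<Longrightarrow> \<exists>c\<in>C. p \<in> fst c"
proof -
  obtain B where B: "countable B"
    and base: "\<forall>U x. openin (manifold_topology A) U \<and> x \<in> U \<longrightarrow> (\<exists>V\<in>B. x \<in> V \<and> V \<subseteq> U)"
    using assms unfolding second_countable_def by (elim exE conjE)
  define f where "f V = (SOME c. c \<in> A \<and> V \<subseteq> fst c)" for V
  have f: "f V \<in> A \<and> V \<subseteq> fst (f V)" if "c \<in> A" "V \<subseteq> fst c" for V c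
    unfolding f_def by (rule someI[of _ c]) (use that in blast)
  let ?B = "{V \<in> B. \<exists>c\<in>A. V \<subseteq> fst c}"
  show thesis
  proof
    show "countable (f ` ?B)" using B by simp
    show "f ` ?B \<subseteq> A" using f by blast
    fix p assume "p \<in> carrier A"
    then obtain c where c: "c \<in> A" "p \<in> fst c" by (auto simp: carrier_def)
    then obtain V where "V \<in> B" "p \<in> V" "V \<subseteq> fst c"
      using base openin_chart_domain[OF c(1)] by meson
    then show "\<exists>c\<in>f ` ?B. p \<in> fst c"
      using f[OF c(1)] c(1) by (intro bexI[of _ "f V"]) auto
  qed
qed

end

section \<open>The slit tangent bundle as a manifold\<close>

text \<open>The map (x, y) to DF(x) y is linear in y. Its x-derivative contributes the second
  derivative of F, its y-derivative DF(x) again. Expanding y in a basis separates the two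
  dependences.\<close>

lemma has_derivative_frechet_derivative_pair:
  fixes F :: "'e::euclidean_space \<Rightarrow> 'b::real_normed_vector"
  assumes S: "open S" "smooth_on S F" "x \<in> S"
  shows "((\<lambda>z. frechet_derivative F (at (fst z)) (snd z)) has_derivative
    (\<lambda>h. frechet_derivative (\<lambda>x. frechet_derivative F (at x) y) (at x) (fst h)
        + frechet_derivative F (at x) (snd h))) (at (x, y))"
proof -
  define G where "G b x = frechet_derivative F (at x) b" for b x
  have lin: "G v x = (\<Sum>b\<in>Basis. (v \<bullet> b) *\<^sub>R G b x)" if "x \<in> S" for v x
    unfolding G_def
    by (rule linear_eq_sum_Basis[OF linear_frechet_derivative_smooth_on[OF S(1,2) that]])
  have G: "(G b has_derivative frechet_derivative (G b) (at x)) (at x)" for b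
    unfolding G_def
    by (rule smooth_on_imp_has_derivative[OF S(1) smooth_on_frechet_derivative[OF S(2)] S(3)])
  have Gfst: "((\<lambda>z. G b (fst z)) has_derivative (\<lambda>h. frechet_derivative (G b) (at x) (fst h))) (at (x, y))" for b
    by (rule has_derivative_compose[OF bounded_linear_imp_has_derivative[OF bounded_linear_fst]]) (simp add: G)
  have isnd: "((\<lambda>z. snd z \<bullet> b) has_derivative (\<lambda>h. snd h \<bullet> b)) (at (x, y))" for b :: 'e
    by (rule bounded_linear_imp_has_derivative)
      (rule bounded_linear_compose[OF bounded_linear_inner_left bounded_linear_snd])
  have "((\<lambda>z. \<Sum>b\<in>Basis. (snd z \<bullet> b) *\<^sub>R G b (fst z)) has_derivative
      (\<lambda>h. \<Sum>b\<in>Basis. (snd (x, y) \<bullet> b) *\<^sub>R frechet_derivative (G b) (at x) (fst h)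
        + (snd h \<bullet> b) *\<^sub>R G b (fst (x, y)))) (at (x, y))"
    by (intro has_derivative_sum has_derivative_scaleR Gfst isnd)
  then have "((\<lambda>z. G (snd z) (fst z)) has_derivative
      (\<lambda>h. \<Sum>b\<in>Basis. (snd (x, y) \<bullet> b) *\<^sub>R frechet_derivative (G b) (at x) (fst h)
        + (snd h \<bullet> b) *\<^sub>R G b (fst (x, y)))) (at (x, y))"
    by (rule has_derivative_transform_within_open[of _ _ _ _ "S \<times> UNIV"])
      (use S(1,3) in \<open>auto simp: open_Times lin[symmetric]\<close>)
  \<comment> \<open>Reassembles the derivatives of the basis coefficients into the derivative of x
    to DF(x) y for the fixed vector y.\<close>
  moreover have "(\<Sum>b\<in>Basis. (y \<bullet> b) *\<^sub>R frechet_derivative (G b) (at x) a) = frechet_derivative (G y) (at x) a" for a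
  proof -
    have "((\<lambda>x. \<Sum>b\<in>Basis. (y \<bullet> b) *\<^sub>R G b x) has_derivative
        (\<lambda>a. \<Sum>b\<in>Basis. (y \<bullet> b) *\<^sub>R frechet_derivative (G b) (at x) a)) (at x)"
      by (intro has_derivative_sum has_derivative_scaleR_right G)
    then have "(G y has_derivative
        (\<lambda>a. \<Sum>b\<in>Basis. (y \<bullet> b) *\<^sub>R frechet_derivative (G b) (at x) a)) (at x)"
      by (rule has_derivative_transform_within_open[OF _ S(1,3)]) (rule lin[symmetric])
    from frechet_derivative_at[OF this] show ?thesis by (rule fun_cong)
  qed
  ultimately show ?thesis
    by (simp add: sum.distrib lin[OF S(3), symmetric]) (simp add: G_def[abs_def])
qed

text \<open>The second derivative D^2F of a change of charts, with a the direction of the inner and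
  b that of the outer differentiation. The order matters until
  \<open>transition_deriv2_commute\<close>.\<close>

definition transition_deriv2 ::
    "('a, 'e::euclidean_space) chart \<Rightarrow> ('a, 'e) chart \<Rightarrow> 'a \<Rightarrow> 'e \<Rightarrow> 'e \<Rightarrow> 'e" where
  "transition_deriv2 c d p a b =
    frechet_derivative (\<lambda>x. frechet_derivative (transition c d) (at x) a) (at (snd c p)) b"

lemma fst_induced_chart:
  "(p, v) \<in> fst (induced_chart A c) \<longleftrightarrow> p \<in> fst c \<and> v \<in> tangent_space A p \<and> v \<noteq> (\<lambda>_. 0)"
  by (simp add: induced_chart_def)

lemma snd_induced_chart: "snd (induced_chart A c) (p, v) = (snd c p, v c)"
  by (simp add: induced_chart_def)

context
  fixes A :: "('a, 'e::euclidean_space) atlas"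
  assumes atlas: "smooth_atlas A"
begin

lemma induced_chart_in_charts_at:
  assumes "c \<in> charts_at A p" "v \<in> tangent_space A p" "v \<noteq> (\<lambda>_. 0)"
  shows "induced_chart A c \<in> charts_at (slit_tangent_bundle A) (p, v)"
  using assms by (auto simp: charts_at_iff slit_tangent_bundle_def fst_induced_chart)

lemma charts_at_slit_tangent_bundleE:
  assumes "d \<in> charts_at (slit_tangent_bundle A) (p, v)"
  obtains c where "d = induced_chart A c" "c \<in> charts_at A p" "v \<in> tangent_space A p" "v \<noteq> (\<lambda>_. 0)"
  using assms by (auto simp: charts_at_iff slit_tangent_bundle_def fst_induced_chart)

lemma carrier_slit_tangent_bundle:
  "(p, v) \<in> carrier (slit_tangent_bundle A) \<longleftrightarrow>
    p \<in> carrier A \<and> v \<in> tangent_space A p \<and> v \<noteq> (\<lambda>_. 0)"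
  unfolding carrier_iff
  by (metis charts_at_slit_tangent_bundleE induced_chart_in_charts_at)

lemma inj_on_induced_chart:
  assumes "c \<in> A"
  shows "inj_on (snd (induced_chart A c)) (fst (induced_chart A c))"
proof (rule inj_onI, clarsimp simp: fst_induced_chart snd_induced_chart)
  fix p v q w
  assume a: "p \<in> fst c" "v \<in> tangent_space A p" "q \<in> fst c" "w \<in> tangent_space A q"
    "snd c p = snd c q" "v c = w c"
  then have "p = q" using inj_on_chart[OF atlas assms] by (auto dest: inj_onD)
  then show "p = q \<and> v = w"
    using a assms tangent_vector_eqI[OF atlas, of c p v w] by (simp add: charts_at_iff)
qed

text \<open>A tangent vector vanishes exactly if its coordinates in one chart do, and all
  coordinates occur. So the image is a product with the punctured model space, which makes openness
  immediate.\<close>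

lemma induced_chart_image_overlap:
  assumes "c \<in> A" "d \<in> A"
  shows "snd (induced_chart A c) ` (fst (induced_chart A c) \<inter> fst (induced_chart A d))
    = snd c ` (fst c \<inter> fst d) \<times> (- {0 :: 'e})"
proof (intro equalityI subsetI)
  fix z assume "z \<in> snd (induced_chart A c) ` (fst (induced_chart A c) \<inter> fst (induced_chart A d))"
  then obtain p v where "z = (snd c p, v c)" "p \<in> fst c" "p \<in> fst d" "v \<in> tangent_space A p" "v \<noteq> (\<lambda>_. 0)"
    by (auto simp: fst_induced_chart snd_induced_chart)
  then show "z \<in> snd c ` (fst c \<inter> fst d) \<times> (- {0 :: 'e})"
    using tangent_vector_eq_0_iff[OF atlas, of c p v] assms by (auto simp: charts_at_iff)
next
  fix z assume "z \<in> snd c ` (fst c \<inter> fst d) \<times> (- {0 :: 'e})"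
  then obtain p y where z: "z = (snd c p, y)" "p \<in> fst c" "p \<in> fst d" "y \<noteq> 0" by auto
  then have c: "c \<in> charts_at A p" using assms by (simp add: charts_at_iff)
  let ?v = "coord_vector A c p y"
  have "(p, ?v) \<in> fst (induced_chart A c) \<inter> fst (induced_chart A d)"
    using z c by (simp add: fst_induced_chart coord_vector_in_tangent_space[OF atlas] coord_vector_eq_0_iff[OF atlas])
  moreover have "snd (induced_chart A c) (p, ?v) = z"
    using z c by (simp add: snd_induced_chart coord_vector_self[OF atlas])
  ultimately show "z \<in> snd (induced_chart A c) ` (fst (induced_chart A c) \<inter> fst (induced_chart A d))"
    by (metis image_eqI)
qed

lemma chart_image_induced_chart:
  "c \<in> A \<Longrightarrow> chart_image (induced_chart A c) = chart_image c \<times> (- {0 :: 'e})"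
  using induced_chart_image_overlap[of c c] by (simp add: chart_image_def)

lemma chart_inv_induced_chart:
  assumes "c \<in> A" "x \<in> chart_image c" "y \<noteq> 0"
  shows "chart_inv (induced_chart A c) (x, y) = (chart_inv c x, coord_vector A c (chart_inv c x) y)"
    (is "_ = ?u")
proof -
  have c: "c \<in> charts_at A (chart_inv c x)"
    using assms by (simp add: charts_at_iff chart_inv_into)
  have "?u \<in> fst (induced_chart A c)"
    using c assms by (simp add: fst_induced_chart charts_at_iff
        coord_vector_in_tangent_space[OF atlas] coord_vector_eq_0_iff[OF atlas])
  moreover have "snd (induced_chart A c) ?u = (x, y)"
    using c assms by (simp add: snd_induced_chart snd_chart_inv coord_vector_self[OF atlas])
  ultimately show ?thesis
    unfolding chart_inv_def[of "induced_chart A c"]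
    using inj_on_induced_chart[OF assms(1)] by (metis inv_into_f_f)
qed

lemma transition_induced_chart:
  assumes "c \<in> A" "d \<in> A" "z \<in> snd c ` (fst c \<inter> fst d) \<times> (- {0 :: 'e})"
  shows "transition (induced_chart A c) (induced_chart A d) z
    = (transition c d (fst z), frechet_derivative (transition c d) (at (fst z)) (snd z))"
proof -
  obtain p y where z: "z = (snd c p, y)" "p \<in> fst c" "p \<in> fst d" "y \<noteq> 0" using assms(3) by auto
  then have c: "c \<in> charts_at A p" "d \<in> charts_at A p" using assms by (simp_all add: charts_at_iff)
  have "chart_inv (induced_chart A c) z = (p, coord_vector A c p y)"
    using chart_inv_induced_chart[OF assms(1), of "snd c p" y] z chart_inv_snd[OF atlas c(1)]
    by (simp add: chart_imageI)
  then show ?thesis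
    using z(1) c by (simp add: transition_def[of "induced_chart A c"] snd_induced_chart
        transition_snd[OF atlas] coord_vector_apply[OF atlas] transition_deriv_def)
qed

lemma smooth_atlas_slit_tangent_bundle: "smooth_atlas (slit_tangent_bundle A)"
  unfolding smooth_atlas_def slit_tangent_bundle_def ball_simps
proof (intro conjI ballI)
  fix c assume c: "c \<in> A"
  show "inj_on (snd (induced_chart A c)) (fst (induced_chart A c))"
    by (rule inj_on_induced_chart[OF c])
  show "open (chart_image (induced_chart A c))"
    unfolding chart_image_induced_chart[OF c]
    using open_chart_image[OF atlas c] by (intro open_Times) auto
  fix d assume d: "d \<in> A"
  let ?S = "snd c ` (fst c \<inter> fst d)" let ?T = "?S \<times> (- {0 :: 'e})"
  have S: "open ?S" by (rule open_overlap[OF atlas c d])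
  then have T: "open ?T" by (intro open_Times) auto
  have fst: "smooth_on ?T fst" and snd: "smooth_on ?T snd"
    by (intro smooth_on_bounded_linear[OF T] bounded_linear_fst bounded_linear_snd)+
  have sub: "fst ` ?T \<subseteq> ?S" by auto
  have "smooth_on ?T (\<lambda>z. (transition c d (fst z), frechet_derivative (transition c d) (at (fst z)) (snd z)))"
    using smooth_on_compose[OF T S sub fst smooth_transition[OF atlas c d]]
      smooth_on_frechet_derivative_apply[OF S T sub smooth_transition[OF atlas c d] fst snd]
    by (rule smooth_on_Pair[OF T])
  then show "smooth_on (snd (induced_chart A c) ` (fst (induced_chart A c) \<inter> fst (induced_chart A d)))
      (transition (induced_chart A c) (induced_chart A d))"
    unfolding induced_chart_image_overlap[OF c d]
    by (rule smooth_on_cong[OF T, rotated]) (simp add: transition_induced_chart[OF c d])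
  show "open (snd (induced_chart A c) ` (fst (induced_chart A c) \<inter> fst (induced_chart A d)))"
    unfolding induced_chart_image_overlap[OF c d] by (rule T)
qed

text \<open>The Jacobian is block triangular. Its D^2F term prevents the second coordinate b from
  transforming as a vector of the base; the Christoffel term in the vertical component compensates
  for it.\<close>

lemma transition_deriv_induced_chart:
  assumes c: "c \<in> charts_at A p" "d \<in> charts_at A p" and v: "v \<in> tangent_space A p" "v \<noteq> (\<lambda>_. 0)"
  shows "transition_deriv (induced_chart A c) (induced_chart A d) (p, v) (a, b)
    = (transition_deriv c d p a, transition_deriv2 c d p (v c) a + transition_deriv c d p b)"
proof -
  let ?S = "snd c ` (fst c \<inter> fst d)" let ?T = "?S \<times> (- {0 :: 'e})" let ?F = "transition c d"
  have cd: "c \<in> A" "d \<in> A" "snd c p \<in> ?S" using c by (auto simp: charts_at_iff)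
  have S: "open ?S" by (rule open_overlap[OF atlas cd(1,2)])
  then have T: "open ?T" by (intro open_Times) auto
  have "v c \<noteq> 0" using tangent_vector_eq_0_iff[OF atlas c(1) v(1)] v(2) by simp
  then have inT: "(snd c p, v c) \<in> ?T" using cd(3) by blast
  have "((\<lambda>z. ?F (fst z)) has_derivative (\<lambda>h. transition_deriv c d p (fst h))) (at (snd c p, v c))"
    by (rule has_derivative_compose[OF bounded_linear_imp_has_derivative[OF bounded_linear_fst]])
      (simp add: has_derivative_transition[OF atlas c])
  from has_derivative_Pair[OF this
      has_derivative_frechet_derivative_pair[OF S smooth_transition[OF atlas cd(1,2)] cd(3), of "v c"]]
  have "(transition (induced_chart A c) (induced_chart A d) has_derivative
      (\<lambda>h. (transition_deriv c d p (fst h), transition_deriv2 c d p (v c) (fst h) + transition_deriv c d p (snd h))))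
      (at (snd c p, v c))"
    unfolding transition_deriv2_def transition_deriv_def
    by (rule has_derivative_transform_within_open[OF _ T inT])
      (simp add: transition_induced_chart[OF cd(1,2)])
  from fun_cong[OF frechet_derivative_at[OF this], of "(a, b)"] show ?thesis
    by (simp add: transition_deriv_def[of "induced_chart A c"] snd_induced_chart)
qed

text \<open>Continuity of the bundle projection, which in induced charts is the projection to the
  first coordinate. It serves to separate points over different base points.\<close>

lemma openin_slit_tangent_bundle_vimage_fst:
  assumes "openin (manifold_topology A) U"
  shows "openin (manifold_topology (slit_tangent_bundle A))
    {u \<in> carrier (slit_tangent_bundle A). fst u \<in> U}" (is "openin _ ?W")
proof (rule openin_manifold_topologyI[OF smooth_atlas_slit_tangent_bundle])
  fix c' assume "c' \<in> slit_tangent_bundle A"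
  then obtain c where c: "c \<in> A" "c' = induced_chart A c" by (auto simp: slit_tangent_bundle_def)
  have "z \<in> snd c' ` (?W \<inter> fst c') \<longleftrightarrow> z \<in> chart_image c' \<and> fst z \<in> snd c ` (U \<inter> fst c)" for z
  proof
    assume "z \<in> snd c' ` (?W \<inter> fst c')"
    then show "z \<in> chart_image c' \<and> fst z \<in> snd c ` (U \<inter> fst c)"
      unfolding c(2) by (auto simp: snd_induced_chart fst_induced_chart chart_image_def image_iff)
  next
    assume z: "z \<in> chart_image c' \<and> fst z \<in> snd c ` (U \<inter> fst c)"
    then obtain p v where u: "(p, v) \<in> fst c'" "z = (snd c p, v c)"
      unfolding c(2) by (auto simp: chart_image_def snd_induced_chart)
    then have "p \<in> U"
      using z inj_on_chart[OF atlas c(1)] unfolding c(2) by (auto simp: fst_induced_chart dest: inj_onD)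
    then have "(p, v) \<in> ?W \<inter> fst c'"
      using u(1) c by (auto simp: carrier_def slit_tangent_bundle_def)
    then show "z \<in> snd c' ` (?W \<inter> fst c')"
      by (rule image_eqI[rotated]) (simp add: u(2) c(2) snd_induced_chart)
  qed
  note image = this
  have domain: "chart_image c' = chart_image c \<times> (- {0 :: 'e})"
    by (simp add: c chart_image_induced_chart)
  have "snd c' ` (?W \<inter> fst c') = snd c ` (U \<inter> fst c) \<times> (- {0 :: 'e})"
    by (rule set_eqI, unfold image domain) (auto simp: chart_image_def)
  then show "open (snd c' ` (?W \<inter> fst c'))"
    using open_image_openin[OF atlas assms c(1)] by (auto intro!: open_Times)
qed auto

lemma smooth_manifold_slit_tangent_bundle:
  assumes haus: "Hausdorff_space (manifold_topology A)" and sc: "second_countable (manifold_topology A)"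
  shows "smooth_manifold (slit_tangent_bundle A)"
  unfolding smooth_manifold_def
proof (intro conjI)
  let ?TA = "slit_tangent_bundle A"
  let ?X = "manifold_topology ?TA"
  show atlas': "smooth_atlas ?TA" by (rule smooth_atlas_slit_tangent_bundle)
  have top: "topspace ?X = carrier ?TA" by (rule topspace_manifold_topology[OF atlas'])
  show "Hausdorff_space ?X"
    unfolding Hausdorff_space_def top
  proof (intro allI impI, elim conjE)
    fix u u' assume u: "u \<in> carrier ?TA" "u' \<in> carrier ?TA" "u \<noteq> u'"
    obtain p v q w where uu: "u = (p, v)" "u' = (q, w)" by fastforce
    have pv: "p \<in> carrier A" "v \<in> tangent_space A p" and qw: "q \<in> carrier A" "w \<in> tangent_space A q"
      using u unfolding uu carrier_slit_tangent_bundle by auto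
    show "\<exists>U V. openin ?X U \<and> openin ?X V \<and> u \<in> U \<and> u' \<in> V \<and> disjnt U V"
    proof (cases "p = q")
      case False
      then obtain U V where UV: "openin (manifold_topology A) U" "openin (manifold_topology A) V"
        "p \<in> U" "q \<in> V" "disjnt U V"
        using haus pv qw unfolding Hausdorff_space_def topspace_manifold_topology[OF atlas] by blast
      show ?thesis
        by (rule exI[of _ "{u \<in> carrier ?TA. fst u \<in> U}"], rule exI[of _ "{u \<in> carrier ?TA. fst u \<in> V}"])
          (use UV u uu in \<open>auto simp: openin_slit_tangent_bundle_vimage_fst disjnt_def\<close>)
    next
      \<comment> \<open>Over one base point both vectors lie in the same induced chart with
        different coordinates, so disjoint open sets of the model space separate them.\<close>
      case True
      obtain c where c: "c \<in> charts_at A p" using pv by (auto simp: carrier_iff)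
      then have "v c \<noteq> w c"
        using tangent_vector_eqI[OF atlas c pv(2)] qw u True uu by auto
      then obtain S T where ST: "open S" "open T" "(snd c p, v c) \<in> S" "(snd c p, w c) \<in> T" "S \<inter> T = {}"
        by (metis Pair_inject separation_t2)
      let ?c = "induced_chart A c"
      have c': "?c \<in> ?TA" using c by (simp add: charts_at_iff slit_tangent_bundle_def)
      have "u \<in> fst ?c" "u' \<in> fst ?c"
        using u c True unfolding uu carrier_slit_tangent_bundle
        by (simp_all add: fst_induced_chart charts_at_iff)
      then show ?thesis
        using ST True openin_chart_preimage[OF atlas' c']
        by (intro exI[of _ "fst ?c \<inter> snd ?c -` S"] exI[of _ "fst ?c \<inter> snd ?c -` T"])
          (auto simp: uu snd_induced_chart disjnt_def)
    qed
  qed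
  show "second_countable ?X"
  proof -
    obtain C where C: "countable C" "C \<subseteq> A" "\<And>p. p \<in> carrier A \<Longrightarrow> \<exists>c\<in>C. p \<in> fst c"
      using countable_chart_cover[OF atlas sc] by metis
    obtain B :: "('e \<times> 'e) set set" where B: "countable B" "topological_basis B"
      using ex_countable_basis by blast
    \<comment> \<open>The countable base consists of the preimages of a countable base of the model
      space under the induced charts of a countable cover.\<close>
    let ?O = "\<lambda>(c, S). fst (induced_chart A c) \<inter> snd (induced_chart A c) -` S"
    show ?thesis
      unfolding second_countable_def
    proof (intro exI[of _ "?O ` (C \<times> B)"] conjI ballI allI impI)
      show "countable (?O ` (C \<times> B))" using B C by (intro countable_image countable_SIGMA)
      show "openin ?X V" if V: "V \<in> ?O ` (C \<times> B)" for V
      proof -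
        obtain c S where cS: "c \<in> C" "S \<in> B" "V = ?O (c, S)" using V by blast
        then have "induced_chart A c \<in> ?TA" "open S"
          using C(2) B(2) topological_basis_open by (auto simp: slit_tangent_bundle_def)
        from openin_chart_preimage[OF atlas' this] show ?thesis by (simp add: cS)
      qed
      fix U u assume U: "openin ?X U \<and> u \<in> U"
      obtain p v where u: "u = (p, v)" by fastforce
      have "u \<in> carrier ?TA" using U openin_subset top by blast
      then have pv: "p \<in> carrier A" "v \<in> tangent_space A p" "v \<noteq> (\<lambda>_. 0)"
        unfolding u carrier_slit_tangent_bundle by auto
      obtain c where c: "c \<in> C" "p \<in> fst c" using C(3) pv(1) by blast
      let ?c = "induced_chart A c"
      have c': "?c \<in> ?TA" using c C(2) by (auto simp: slit_tangent_bundle_def)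
      have uc: "u \<in> fst ?c" using c pv by (simp add: u fst_induced_chart)
      have "open (snd ?c ` (U \<inter> fst ?c))" by (rule open_image_openin[OF atlas' _ c']) (use U in blast)
      then obtain S where S: "S \<in> B" "snd ?c u \<in> S" "S \<subseteq> snd ?c ` (U \<inter> fst ?c)"
        using topological_basisE[OF B(2), of "snd ?c ` (U \<inter> fst ?c)" "snd ?c u"] U uc by blast
      have "?O (c, S) \<subseteq> U"
      proof
        fix w assume "w \<in> ?O (c, S)"
        then have "w \<in> fst ?c" "snd ?c w \<in> snd ?c ` (U \<inter> fst ?c)" using S(3) by auto
        then show "w \<in> U"
          using inj_on_image_mem_iff[OF inj_on_chart[OF atlas' c'], of w "U \<inter> fst ?c"] by blast
      qed
      moreover have "u \<in> ?O (c, S)" using uc S(2) by simp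
      ultimately show "\<exists>V\<in>?O ` (C \<times> B). u \<in> V \<and> V \<subseteq> U"
        using c(1) S(1) by (intro bexI[of _ "?O (c, S)"]) auto
    qed
  qed
qed

end

section \<open>The metric and the Christoffel symbols in charts\<close>

lemma linear_eq_sum_axis:
  fixes L :: "real ^ 'n \<Rightarrow> 'b::real_vector"
  assumes "linear L"
  shows "L a = (\<Sum>i\<in>UNIV. a $ i *\<^sub>R L (axis i 1))"
proof -
  have "L a = L (\<Sum>i\<in>UNIV. a $ i *\<^sub>R axis i 1)"
    using basis_expansion[of a] by (simp add: scalar_mult_eq_scaleR)
  then show ?thesis
    by (simp add: linear_sum[OF assms] linear_scale[OF assms] o_def)
qed

definition metric_form ::
    "('a, real ^ 'n) atlas \<Rightarrow> ('a \<Rightarrow> ('a, real ^ 'n) tvec \<Rightarrow> ('a, real ^ 'n) tvec \<Rightarrow> real) \<Rightarrow>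
     ('a, real ^ 'n) chart \<Rightarrow> real ^ 'n \<Rightarrow> real ^ 'n \<Rightarrow> real ^ 'n \<Rightarrow> real" where
  "metric_form A g c x a b = (\<Sum>i\<in>UNIV. \<Sum>j\<in>UNIV. g_matrix A g c x $ i $ j * a $ i * b $ j)"

text \<open>The derivative of \<open>g(a, b)\<close> at \<open>x\<close> in the direction \<open>z\<close>, with \<open>a\<close> and \<open>b\<close> constant in
  the chart.\<close>

definition metric_deriv ::
    "('a, real ^ 'n) atlas \<Rightarrow> ('a \<Rightarrow> ('a, real ^ 'n) tvec \<Rightarrow> ('a, real ^ 'n) tvec \<Rightarrow> real) \<Rightarrow>
     ('a, real ^ 'n) chart \<Rightarrow> real ^ 'n \<Rightarrow> real ^ 'n \<Rightarrow> real ^ 'n \<Rightarrow> real ^ 'n \<Rightarrow> real" where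
  "metric_deriv A g c x z a b =
    (\<Sum>i\<in>UNIV. \<Sum>j\<in>UNIV. frechet_derivative (\<lambda>x. g_matrix A g c x $ i $ j) (at x) z * a $ i * b $ j)"

text \<open>Gamma(a, b), the Christoffel symbols extended bilinearly to vectors. At the pair of y
  and a basis vector it is the correction term of the horizontal frame.\<close>

definition christoffel_form ::
    "('a, real ^ 'n) atlas \<Rightarrow> ('a \<Rightarrow> ('a, real ^ 'n) tvec \<Rightarrow> ('a, real ^ 'n) tvec \<Rightarrow> real) \<Rightarrow>
     ('a, real ^ 'n) chart \<Rightarrow> real ^ 'n \<Rightarrow> real ^ 'n \<Rightarrow> real ^ 'n \<Rightarrow> real ^ 'n" where
  "christoffel_form A g c x a b =
    (\<chi> k. \<Sum>i\<in>UNIV. \<Sum>j\<in>UNIV. a $ i * b $ j * christoffel A g c x i j k)"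

lemma linear_metric_form_left: "linear (\<lambda>a. metric_form A g c x a b)"
  by (rule linearI)
    (simp_all add: metric_form_def sum.distrib sum_distrib_left distrib_left distrib_right mult_ac)

lemma linear_metric_form_right: "linear (\<lambda>b. metric_form A g c x a b)"
  by (rule linearI)
    (simp_all add: metric_form_def sum.distrib sum_distrib_left distrib_left distrib_right mult_ac)

lemmas metric_form_add_left = linear_add[OF linear_metric_form_left]
lemmas metric_form_add_right = linear_add[OF linear_metric_form_right]
lemmas metric_form_scale_left = linear_scale[OF linear_metric_form_left, unfolded real_scaleR_def]
lemmas metric_form_scale_right = linear_scale[OF linear_metric_form_right, unfolded real_scaleR_def]

lemma linear_christoffel_form_right: "linear (\<lambda>b. christoffel_form A g c x a b)"
  by (rule linearI)
    (simp_all add: christoffel_form_def vec_eq_iff sum.distrib sum_distrib_left distrib_left distrib_right mult_ac)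

lemma metric_form_eq_inner: "metric_form A g c x a b = a \<bullet> (g_matrix A g c x *v b)"
  by (simp add: metric_form_def inner_vec_def matrix_vector_mult_def sum_distrib_left mult_ac)

lemma sum_rotate3:
  "(\<Sum>l\<in>C. \<Sum>i\<in>A. \<Sum>j\<in>B. f i j l) = (\<Sum>i\<in>A. \<Sum>j\<in>B. \<Sum>l\<in>C. f i j l)"
proof -
  have "(\<Sum>l\<in>C. \<Sum>i\<in>A. \<Sum>j\<in>B. f i j l) = (\<Sum>i\<in>A. \<Sum>l\<in>C. \<Sum>j\<in>B. f i j l)"
    by (rule sum.swap)
  also have "\<dots> = (\<Sum>i\<in>A. \<Sum>j\<in>B. \<Sum>l\<in>C. f i j l)"
    by (intro sum.cong refl sum.swap)
  finally show ?thesis .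
qed

context
  fixes A :: "('a, real ^ 'n) atlas"
    and g :: "'a \<Rightarrow> ('a, real ^ 'n) tvec \<Rightarrow> ('a, real ^ 'n) tvec \<Rightarrow> real"
  assumes atlas: "smooth_atlas A" and metric: "riemannian_metric A g"
begin

lemma smooth_g_matrix:
  assumes "c \<in> A"
  shows "smooth_on (chart_image c) (\<lambda>x. g_matrix A g c x $ i $ j)"
proof -
  have "axis k 1 \<in> (Basis :: (real ^ 'n) set)" for k
    by (simp add: axis_in_Basis_iff)
  then show ?thesis
    using metric assms by (simp add: g_matrix_def riemannian_metric_def symmetric_tensor_field_def)
qed

text \<open>Identifies the coordinate form with the invariant g by bilinear expansion. Symmetry,
  positivity and independence of the chart all pass to the coordinate form through this
  identity.\<close>

lemma metric_form_eq:
  assumes c: "c \<in> charts_at A p"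
  shows "metric_form A g c (snd c p) a b = g p (coord_vector A c p a) (coord_vector A c p b)"
proof -
  let ?B = "\<lambda>a b. g p (coord_vector A c p a) (coord_vector A c p b)"
  have p: "p \<in> carrier A" using c by (rule charts_at_imp_carrier)
  then have bil: "symmetric_bilinear_on (tangent_space A p) (g p)"
    using metric by (simp add: riemannian_metric_def symmetric_tensor_field_def)
  have T: "coord_vector A c p e \<in> tangent_space A p" for e
    by (rule coord_vector_in_tangent_space[OF atlas c])
  have comb: "?B (r *\<^sub>R a + s *\<^sub>R a') b = r * ?B a b + s * ?B a' b" for r s a a' b
    using bil T unfolding coord_vector_linear[OF atlas c] symmetric_bilinear_on_def by blast
  have sym: "?B a b = ?B b a" for a b
    using bil T unfolding symmetric_bilinear_on_def by blast
  have lin1: "linear (\<lambda>a. ?B a b)" for b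
    using comb[of 1 _ 1] comb[of _ _ 0] by (intro linearI) simp_all
  have lin2: "linear (\<lambda>b. ?B a b)" for a
    using lin1[of a] by (simp add: sym)
  have "?B a b = (\<Sum>i\<in>UNIV. a $ i * ?B (axis i 1) b)"
    using linear_eq_sum_axis[OF lin1, of a b] by simp
  also have "\<dots> = (\<Sum>i\<in>UNIV. a $ i * (\<Sum>j\<in>UNIV. b $ j * ?B (axis i 1) (axis j 1)))"
    using linear_eq_sum_axis[OF lin2, of _ b] by simp
  finally show ?thesis
    by (simp add: metric_form_def g_matrix_def chart_inv_snd[OF atlas c] sum_distrib_left mult_ac)
qed

lemma metric_form_commute:
  assumes "c \<in> charts_at A p"
  shows "metric_form A g c (snd c p) a b = metric_form A g c (snd c p) b a"
proof -
  have "p \<in> carrier A" by (rule charts_at_imp_carrier[OF assms])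
  then show ?thesis
    using metric coord_vector_in_tangent_space[OF atlas assms] metric_form_eq[OF assms]
    by (simp add: riemannian_metric_def symmetric_tensor_field_def symmetric_bilinear_on_def)
qed

lemma metric_form_transition:
  assumes "c \<in> charts_at A p" "d \<in> charts_at A p"
  shows "metric_form A g d (snd d p) (transition_deriv c d p a) (transition_deriv c d p b)
    = metric_form A g c (snd c p) a b"
  using assms by (simp add: metric_form_eq coord_vector_transition[OF atlas])

lemma metric_form_pos:
  assumes "c \<in> charts_at A p" "a \<noteq> 0"
  shows "metric_form A g c (snd c p) a a > 0"
proof -
  have "p \<in> carrier A" by (rule charts_at_imp_carrier[OF assms(1)])
  then show ?thesis
    using metric assms unfolding metric_form_eq[OF assms(1)] riemannian_metric_def
    by (simp add: coord_vector_in_tangent_space[OF atlas] coord_vector_eq_0_iff[OF atlas])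
qed

lemma metric_form_nondegenerate:
  assumes "c \<in> charts_at A p" "\<And>b. metric_form A g c (snd c p) a b = 0"
  shows "a = 0"
  using metric_form_pos[OF assms(1), of a] assms(2)[of a] by force

text \<open>A vector in the kernel would have length zero, contradicting positive definiteness.
  Without this, \<open>matrix_inv\<close> in \<open>christoffel\<close> would be an unspecified
  value.\<close>

lemma invertible_g_matrix:
  assumes "c \<in> charts_at A p"
  shows "invertible (g_matrix A g c (snd c p))"
proof -
  have "b = 0" if "g_matrix A g c (snd c p) *v b = 0" for b
    using metric_form_pos[OF assms, of b] that by (auto simp: metric_form_eq_inner)
  then show ?thesis
    by (metis invertible_left_inverse matrix_left_invertible_ker)
qed

lemma has_derivative_g_matrix:
  assumes "c \<in> charts_at A p"
  shows "((\<lambda>x. g_matrix A g c x $ i $ j) has_derivative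
    frechet_derivative (\<lambda>x. g_matrix A g c x $ i $ j) (at (snd c p))) (at (snd c p))"
  using assms by (intro smooth_on_imp_has_derivative[OF open_chart_image smooth_g_matrix])
    (auto simp: charts_at_iff atlas intro: chart_imageI)

lemma has_derivative_metric_form:
  assumes "c \<in> charts_at A p"
  shows "((\<lambda>x. metric_form A g c x a b) has_derivative (\<lambda>z. metric_deriv A g c (snd c p) z a b)) (at (snd c p))"
  unfolding metric_form_def metric_deriv_def
  by (intro has_derivative_sum has_derivative_mult_left has_derivative_g_matrix[OF assms])

lemma metric_deriv_eq_sum:
  assumes "c \<in> charts_at A p"
  shows "metric_deriv A g c (snd c p) z a b
    = (\<Sum>k\<in>UNIV. \<Sum>i\<in>UNIV. \<Sum>j\<in>UNIV. dg A g c (snd c p) k i j * z $ k * a $ i * b $ j)"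
proof -
  have "frechet_derivative (\<lambda>x. g_matrix A g c x $ i $ j) (at (snd c p)) z
      = (\<Sum>k\<in>UNIV. z $ k * dg A g c (snd c p) k i j)" for i j
    using linear_eq_sum_axis[OF has_derivative_linear[OF has_derivative_g_matrix[OF assms]], of i j z]
    by (simp add: dg_def)
  then have "metric_deriv A g c (snd c p) z a b
    = (\<Sum>i\<in>UNIV. \<Sum>j\<in>UNIV. \<Sum>k\<in>UNIV. dg A g c (snd c p) k i j * z $ k * a $ i * b $ j)"
    by (simp add: metric_deriv_def sum_distrib_left sum_distrib_right mult_ac)
  then show ?thesis
    by (rule trans) (rule sum_rotate3[symmetric])
qed

text \<open>The Koszul formula for vector fields with constant coordinates: their brackets vanish
  and three derivatives of the metric remain. Pairing with the metric cancels the inverse matrix in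
  \<open>christoffel\<close>.\<close>

lemma metric_form_christoffel_form:
  assumes c: "c \<in> charts_at A p"
  shows "metric_form A g c (snd c p) (christoffel_form A g c (snd c p) a b) z
    = (metric_deriv A g c (snd c p) a b z + metric_deriv A g c (snd c p) b a z
       - metric_deriv A g c (snd c p) z a b) / 2"
proof -
  let ?x = "snd c p"
  let ?G = "g_matrix A g c ?x"
  let ?dg = "dg A g c ?x"
  \<comment> \<open>Twice the Christoffel symbols of the first kind, contracted with a and b;
    raising the index with the inverse metric gives
    \<open>2 *\<^sub>R christoffel_form\<close>.\<close>
  define S :: "real ^ 'n" where
    "S = (\<chi> l. \<Sum>i\<in>UNIV. \<Sum>j\<in>UNIV. (?dg i j l + ?dg j i l - ?dg l i j) * a $ i * b $ j)"
  have Gam: "christoffel_form A g c ?x a b = (1 / 2) *\<^sub>R (matrix_inv ?G *v S)"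
  proof (rule vec_eq_iff[THEN iffD2], rule allI)
    fix k
    have chr: "2 * christoffel A g c ?x i j k
        = (\<Sum>l\<in>UNIV. matrix_inv ?G $ k $ l * (?dg i j l + ?dg j i l - ?dg l i j))" for i j
      by (simp add: christoffel_def)
    have "(matrix_inv ?G *v S) $ k = (\<Sum>l\<in>UNIV. \<Sum>i\<in>UNIV. \<Sum>j\<in>UNIV.
        matrix_inv ?G $ k $ l * ((?dg i j l + ?dg j i l - ?dg l i j) * a $ i * b $ j))"
      by (simp add: matrix_vector_mult_def S_def sum_distrib_left)
    also have "\<dots> = (\<Sum>i\<in>UNIV. \<Sum>j\<in>UNIV. \<Sum>l\<in>UNIV.
        matrix_inv ?G $ k $ l * ((?dg i j l + ?dg j i l - ?dg l i j) * a $ i * b $ j))"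
      by (rule sum_rotate3)
    also have "\<dots> = (\<Sum>i\<in>UNIV. \<Sum>j\<in>UNIV. a $ i * b $ j * (2 * christoffel A g c ?x i j k))"
      unfolding chr by (simp add: sum_distrib_left mult_ac)
    also have "\<dots> = 2 * christoffel_form A g c ?x a b $ k"
      by (simp add: christoffel_form_def sum_distrib_left mult_ac)
    finally show "christoffel_form A g c ?x a b $ k = ((1 / 2) *\<^sub>R (matrix_inv ?G *v S)) $ k"
      by simp
  qed
  have GS: "?G *v (matrix_inv ?G *v S) = S"
    using matrix_inv_right[OF invertible_g_matrix[OF c]] by (simp add: matrix_vector_mul_assoc)
  have "metric_form A g c ?x (christoffel_form A g c ?x a b) z
      = z \<bullet> (?G *v christoffel_form A g c ?x a b)"
    using metric_form_commute[OF c] metric_form_eq_inner by metis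
  also have "\<dots> = (z \<bullet> S) / 2"
    unfolding Gam by (simp add: matrix_vector_mult_scaleR GS)
  also have "z \<bullet> S = (\<Sum>l\<in>UNIV. \<Sum>i\<in>UNIV. \<Sum>j\<in>UNIV. ?dg i j l * a $ i * b $ j * z $ l)
      + (\<Sum>l\<in>UNIV. \<Sum>i\<in>UNIV. \<Sum>j\<in>UNIV. ?dg j i l * a $ i * b $ j * z $ l)
      - (\<Sum>l\<in>UNIV. \<Sum>i\<in>UNIV. \<Sum>j\<in>UNIV. ?dg l i j * a $ i * b $ j * z $ l)"
    by (simp add: inner_vec_def S_def sum_distrib_left sum.distrib sum_subtractf algebra_simps)
  also have "(\<Sum>l\<in>UNIV. \<Sum>i\<in>UNIV. \<Sum>j\<in>UNIV. ?dg i j l * a $ i * b $ j * z $ l) = metric_deriv A g c ?x a b z"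
    unfolding metric_deriv_eq_sum[OF c] by (rule sum_rotate3)
  also have "(\<Sum>l\<in>UNIV. \<Sum>i\<in>UNIV. \<Sum>j\<in>UNIV. ?dg j i l * a $ i * b $ j * z $ l)
      = (\<Sum>i\<in>UNIV. \<Sum>j\<in>UNIV. \<Sum>l\<in>UNIV. ?dg j i l * a $ i * b $ j * z $ l)"
    by (rule sum_rotate3)
  also have "\<dots> = (\<Sum>j\<in>UNIV. \<Sum>i\<in>UNIV. \<Sum>l\<in>UNIV. ?dg j i l * a $ i * b $ j * z $ l)"
    by (rule sum.swap)
  also have "\<dots> = metric_deriv A g c ?x b a z"
    unfolding metric_deriv_eq_sum[OF c] by (simp add: mult_ac)
  also have "(\<Sum>l\<in>UNIV. \<Sum>i\<in>UNIV. \<Sum>j\<in>UNIV. ?dg l i j * a $ i * b $ j * z $ l) = metric_deriv A g c ?x z a b"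
    unfolding metric_deriv_eq_sum[OF c] by (simp add: mult_ac)
  finally show ?thesis .
qed

section \<open>Transformation of the Christoffel symbols under a change of charts\<close>

lemma has_derivative_transition_deriv_apply:
  assumes "c \<in> charts_at A p" "d \<in> charts_at A p"
  shows "((\<lambda>x. frechet_derivative (transition c d) (at x) a) has_derivative transition_deriv2 c d p a) (at (snd c p))"
  unfolding transition_deriv2_def using assms
  by (intro smooth_on_imp_has_derivative[OF open_overlap smooth_on_frechet_derivative[OF smooth_transition]])
    (auto simp: charts_at_iff atlas)

lemma transition_deriv2_commute:
  assumes "c \<in> charts_at A p" "d \<in> charts_at A p"
  shows "transition_deriv2 c d p a b = transition_deriv2 c d p b a"
  unfolding transition_deriv2_def using assms
  by (intro second_derivative_symmetric[OF open_overlap smooth_transition])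
    (auto simp: charts_at_iff atlas)

text \<open>Differentiates g'(DF a, DF b) = g(a, b) along z, with a and b constant in c. The product
  rule gives one term from the metric and one from each Jacobian.\<close>

lemma metric_deriv_transition:
  assumes c: "c \<in> charts_at A p" and d: "d \<in> charts_at A p"
  shows "metric_deriv A g c (snd c p) z a b
    = metric_deriv A g d (snd d p) (transition_deriv c d p z) (transition_deriv c d p a) (transition_deriv c d p b)
      + metric_form A g d (snd d p) (transition_deriv2 c d p a z) (transition_deriv c d p b)
      + metric_form A g d (snd d p) (transition_deriv c d p a) (transition_deriv2 c d p b z)"
proof -
  let ?S = "snd c ` (fst c \<inter> fst d)" and ?x = "snd c p" and ?F = "transition c d"
  let ?DF = "\<lambda>a x. frechet_derivative ?F (at x) a"
  let ?T = "transition_deriv c d p"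
  let ?dG = "\<lambda>i j. frechet_derivative (\<lambda>x. g_matrix A g d x $ i $ j) (at (snd d p))"
  have cd: "c \<in> A" "d \<in> A" using c d by (auto simp: charts_at_iff)
  have S: "open ?S" "?x \<in> ?S" using c d by (auto simp: charts_at_iff open_overlap[OF atlas])
  have eq: "metric_form A g d (?F x) (?DF a x) (?DF b x) = metric_form A g c x a b" if "x \<in> ?S" for x
  proof -
    obtain q where q: "x = snd c q" "c \<in> charts_at A q" "d \<in> charts_at A q"
      using \<open>x \<in> ?S\<close> cd by (auto simp: charts_at_iff)
    show ?thesis
      using metric_form_transition[OF q(2,3)] unfolding q(1) transition_deriv_def transition_snd[OF atlas q(2)] .
  qed
  have G: "((\<lambda>x. g_matrix A g d (?F x) $ i $ j) has_derivative (\<lambda>z. ?dG i j (?T z))) (at ?x)" for i j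
    by (rule has_derivative_compose[OF has_derivative_transition[OF atlas c d]])
      (simp add: transition_snd[OF atlas c] has_derivative_g_matrix[OF d])
  have DF: "((\<lambda>x. ?DF a x $ i) has_derivative (\<lambda>z. transition_deriv2 c d p a z $ i)) (at ?x)" for a i
    by (rule bounded_linear.has_derivative[OF bounded_linear_vec_nth has_derivative_transition_deriv_apply[OF c d]])
  have "((\<lambda>x. metric_form A g d (?F x) (?DF a x) (?DF b x)) has_derivative
      (\<lambda>z. \<Sum>i\<in>UNIV. \<Sum>j\<in>UNIV.
        g_matrix A g d (?F ?x) $ i $ j * ?DF a ?x $ i * transition_deriv2 c d p b z $ j
        + (g_matrix A g d (?F ?x) $ i $ j * transition_deriv2 c d p a z $ i
           + ?dG i j (?T z) * ?DF a ?x $ i) * ?DF b ?x $ j)) (at ?x)"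
    unfolding metric_form_def by (intro has_derivative_sum has_derivative_mult G DF)
  then have "((\<lambda>x. metric_form A g c x a b) has_derivative
      (\<lambda>z. \<Sum>i\<in>UNIV. \<Sum>j\<in>UNIV.
        g_matrix A g d (?F ?x) $ i $ j * ?DF a ?x $ i * transition_deriv2 c d p b z $ j
        + (g_matrix A g d (?F ?x) $ i $ j * transition_deriv2 c d p a z $ i
           + ?dG i j (?T z) * ?DF a ?x $ i) * ?DF b ?x $ j)) (at ?x)"
    by (rule has_derivative_transform_within_open[OF _ S]) (rule eq)
  from fun_cong[OF has_derivative_unique[OF has_derivative_metric_form[OF c] this], of z]
  show ?thesis
    unfolding transition_deriv_def[symmetric] transition_snd[OF atlas c]
    by (simp add: metric_form_def metric_deriv_def sum.distrib algebra_simps)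
qed

lemma christoffel_form_transition:
  assumes c: "c \<in> charts_at A p" and d: "d \<in> charts_at A p"
  shows "transition_deriv c d p (christoffel_form A g c (snd c p) a b)
    = transition_deriv2 c d p a b
      + christoffel_form A g d (snd d p) (transition_deriv c d p a) (transition_deriv c d p b)"
proof -
  let ?T = "transition_deriv c d p" and ?D2 = "transition_deriv2 c d p"
  let ?f = "metric_form A g d (snd d p)" and ?D = "metric_deriv A g d (snd d p)"
  let ?w = "?T (christoffel_form A g c (snd c p) a b)"
    and ?w' = "?D2 a b + christoffel_form A g d (snd d p) (?T a) (?T b)"
  have *: "?f ?w (?T z) = ?f ?w' (?T z)" for z
  proof -
    have "2 * ?f ?w (?T z) = metric_deriv A g c (snd c p) a b z + metric_deriv A g c (snd c p) b a z
       - metric_deriv A g c (snd c p) z a b"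
      by (simp add: metric_form_transition[OF c d] metric_form_christoffel_form[OF c])
    \<comment> \<open>The three instances of \<open>metric_deriv_transition\<close> produce six D^2F
      terms. By symmetry of D^2F and of the metric, two pairs cancel and the other two both equal
      \<open>?f (?D2 a b) (?T z)\<close>.\<close>
    also have "\<dots> = ?D (?T a) (?T b) (?T z) + ?D (?T b) (?T a) (?T z) - ?D (?T z) (?T a) (?T b)
        + 2 * ?f (?D2 a b) (?T z)"
      unfolding metric_deriv_transition[OF c d]
        transition_deriv2_commute[OF c d, of b a] transition_deriv2_commute[OF c d, of z]
        metric_form_commute[OF d, of "?T _" "?D2 _ _"]
      by simp
    also have "\<dots> = 2 * ?f ?w' (?T z)"
      by (simp add: metric_form_add_left metric_form_christoffel_form[OF d])
    finally show ?thesis by simp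
  qed
  \<comment> \<open>The Jacobian is surjective: y is the image of its transform back to c. So the
    test vectors \<open>?T z\<close> are all vectors, and nondegeneracy applies.\<close>
  have "?f (?w - ?w') y = 0" for y
    using *[of "transition_deriv d c p y"] transition_deriv_inverse[OF atlas d c]
    by (simp add: linear_diff[OF linear_metric_form_left])
  from metric_form_nondegenerate[OF d this] show ?thesis by simp
qed

lemma smooth_christoffel:
  assumes "c \<in> A"
  shows "smooth_on (chart_image c) (\<lambda>x. christoffel A g c x i j k)"
proof -
  let ?S = "chart_image c"
  have S: "open ?S" by (rule open_chart_image[OF atlas assms])
  have inv: "smooth_on ?S (\<lambda>x. matrix_inv (g_matrix A g c x) $ k $ l)" for k l
  proof (rule smooth_on_matrix_inv_nth[OF S smooth_g_matrix[OF assms]])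
    fix x assume "x \<in> ?S"
    then show "invertible (g_matrix A g c x)"
      using invertible_g_matrix[of c "chart_inv c x"] assms
      by (simp add: charts_at_iff chart_inv_into snd_chart_inv)
  qed
  have "smooth_on ?S (\<lambda>x. dg A g c x i j k)" for i j k
    unfolding dg_def by (rule smooth_on_frechet_derivative[OF smooth_g_matrix[OF assms]])
  then show ?thesis
    unfolding christoffel_def
    by (intro smooth_on_divide smooth_on_sum smooth_on_mult smooth_on_add smooth_on_diff S inv smooth_on_const)
      auto
qed

end

section \<open>The tensors in coordinates\<close>

text \<open>A tangent vector of the slit tangent bundle with coordinates \<open>(a, b)\<close> at \<open>(x, y)\<close> has
  horizontal component \<open>a\<close> and vertical component \<open>b + \<Gamma>(y, a)\<close>, the value of \<open>\<delta>y\<close> on it.\<close>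

definition vertical_part ::
    "('a, real ^ 'n) atlas \<Rightarrow> ('a \<Rightarrow> ('a, real ^ 'n) tvec \<Rightarrow> ('a, real ^ 'n) tvec \<Rightarrow> real) \<Rightarrow>
     ('a, real ^ 'n) chart \<Rightarrow> real ^ 'n \<Rightarrow> real ^ 'n \<Rightarrow> (real ^ 'n) \<times> (real ^ 'n) \<Rightarrow> real ^ 'n" where
  "vertical_part A g c x y e = snd e + christoffel_form A g c x y (fst e)"

definition g2_coord ::
    "('a, real ^ 'n) atlas \<Rightarrow> ('a \<Rightarrow> ('a, real ^ 'n) tvec \<Rightarrow> ('a, real ^ 'n) tvec \<Rightarrow> real) \<Rightarrow>
     ('a, real ^ 'n) chart \<Rightarrow> real ^ 'n \<Rightarrow> real ^ 'n \<Rightarrow>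
     (real ^ 'n) \<times> (real ^ 'n) \<Rightarrow> (real ^ 'n) \<times> (real ^ 'n) \<Rightarrow> real" where
  "g2_coord A g c x y e e' = 2 / sqrt (metric_form A g c x y y) *
    (metric_form A g c x (fst e) (vertical_part A g c x y e')
      + metric_form A g c x (fst e') (vertical_part A g c x y e))"

text \<open>The first component is the new horizontal part w/N. Subtracting its Christoffel term
  converts the new vertical part -N a back into a coordinate of the induced chart.\<close>

definition J_coord ::
    "('a, real ^ 'n) atlas \<Rightarrow> ('a \<Rightarrow> ('a, real ^ 'n) tvec \<Rightarrow> ('a, real ^ 'n) tvec \<Rightarrow> real) \<Rightarrow>
     ('a, real ^ 'n) chart \<Rightarrow> real ^ 'n \<Rightarrow> real ^ 'n \<Rightarrow>
     (real ^ 'n) \<times> (real ^ 'n) \<Rightarrow> (real ^ 'n) \<times> (real ^ 'n)" where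
  "J_coord A g c x y e =
    ((1 / sqrt (metric_form A g c x y y)) *\<^sub>R vertical_part A g c x y e,
     - sqrt (metric_form A g c x y y) *\<^sub>R fst e
       - christoffel_form A g c x y ((1 / sqrt (metric_form A g c x y y)) *\<^sub>R vertical_part A g c x y e))"

text \<open>Lifting arbitrary vectors instead of basis vectors lets a change of charts be expressed
  by applying the Jacobian to the lifted vector; the frame is recovered at
  \<open>axis i 1\<close>.\<close>

definition horizontal_lift ::
    "('a, real ^ 'n) atlas \<Rightarrow> ('a \<Rightarrow> ('a, real ^ 'n) tvec \<Rightarrow> ('a, real ^ 'n) tvec \<Rightarrow> real) \<Rightarrow>
     ('a, real ^ 'n) chart \<Rightarrow> 'a \<times> ('a, real ^ 'n) tvec \<Rightarrow> real ^ 'n \<Rightarrow>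
     ('a \<times> ('a, real ^ 'n) tvec, (real ^ 'n) \<times> (real ^ 'n)) tvec" where
  "horizontal_lift A g c u a = coord_vector (slit_tangent_bundle A) (induced_chart A c) u
    (a, - christoffel_form A g c (snd c (fst u)) (snd u c) a)"

definition vertical_lift ::
    "('a, real ^ 'n) atlas \<Rightarrow>
     ('a, real ^ 'n) chart \<Rightarrow> 'a \<times> ('a, real ^ 'n) tvec \<Rightarrow> real ^ 'n \<Rightarrow>
     ('a \<times> ('a, real ^ 'n) tvec, (real ^ 'n) \<times> (real ^ 'n)) tvec" where
  "vertical_lift A c u b = coord_vector (slit_tangent_bundle A) (induced_chart A c) u (0, b)"

lemmas christoffel_form_add = linear_add[OF linear_christoffel_form_right]
lemmas christoffel_form_scale = linear_scale[OF linear_christoffel_form_right]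
lemmas christoffel_form_0 = linear_0[OF linear_christoffel_form_right]
lemmas christoffel_form_minus = linear_neg[OF linear_christoffel_form_right]

lemma vertical_part_linear:
  "vertical_part A g c x y (r *\<^sub>R e + s *\<^sub>R e')
    = r *\<^sub>R vertical_part A g c x y e + s *\<^sub>R vertical_part A g c x y e'"
  by (simp add: vertical_part_def christoffel_form_add christoffel_form_scale algebra_simps)

lemma g2_coord_linear:
  "g2_coord A g c x y (r *\<^sub>R e + s *\<^sub>R e') f = r * g2_coord A g c x y e f + s * g2_coord A g c x y e' f"
  by (simp add: g2_coord_def vertical_part_linear metric_form_add_left metric_form_add_right
      metric_form_scale_left metric_form_scale_right algebra_simps add_divide_distrib)

lemma g2_coord_commute: "g2_coord A g c x y e e' = g2_coord A g c x y e' e"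
  by (simp add: g2_coord_def add.commute)

lemma J_coord_linear:
  "J_coord A g c x y (r *\<^sub>R e + s *\<^sub>R e') = r *\<^sub>R J_coord A g c x y e + s *\<^sub>R J_coord A g c x y e'"
  by (simp add: J_coord_def vertical_part_linear christoffel_form_add christoffel_form_scale
      prod_eq_iff algebra_simps)

lemma fst_J_coord:
  "fst (J_coord A g c x y e) = (1 / sqrt (metric_form A g c x y y)) *\<^sub>R vertical_part A g c x y e"
  by (simp add: J_coord_def)

lemma vertical_part_J_coord:
  "vertical_part A g c x y (J_coord A g c x y e) = - sqrt (metric_form A g c x y y) *\<^sub>R fst e"
  by (simp add: J_coord_def vertical_part_def)

text \<open>Passing from coordinates to horizontal and vertical components is triangular, hence
  injective, so identities such as J^2 = -I can be checked on components.\<close>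

lemma prod_eq_vertical_partI:
  "fst e = fst e' \<Longrightarrow> vertical_part A g c x y e = vertical_part A g c x y e' \<Longrightarrow> e = e'"
  by (simp add: vertical_part_def prod_eq_iff)

lemma vertical_part_minus: "vertical_part A g c x y (- e) = - vertical_part A g c x y e"
  by (simp add: vertical_part_def christoffel_form_minus)

lemma J_coord_J_coord:
  assumes "metric_form A g c x y y > 0"
  shows "J_coord A g c x y (J_coord A g c x y e) = - e"
  by (rule prod_eq_vertical_partI[of _ _ A g c x y])
    (use assms in \<open>simp_all add: fst_J_coord vertical_part_J_coord vertical_part_minus\<close>)

lemma linear_eq_on_axis:
  fixes L M :: "real ^ 'n \<Rightarrow> 'b::real_vector"
  assumes "linear L" "linear M" "\<And>i. L (axis i 1) = M (axis i 1)"
  shows "L a = M a"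
  unfolding linear_eq_sum_axis[OF assms(1), of a] linear_eq_sum_axis[OF assms(2), of a] assms(3) ..

lemma bilinear_eq_on_axis:
  fixes B C :: "real ^ 'n \<Rightarrow> real ^ 'n \<Rightarrow> 'b::real_vector"
  assumes "\<And>b. linear (\<lambda>a. B a b)" "\<And>a. linear (B a)" "\<And>b. linear (\<lambda>a. C a b)" "\<And>a. linear (C a)"
    and "\<And>i j. B (axis i 1) (axis j 1) = C (axis i 1) (axis j 1)"
  shows "B a b = C a b"
proof (rule linear_eq_on_axis[OF assms(1,3)])
  show "B (axis i 1) b = C (axis i 1) b" for i
    by (rule linear_eq_on_axis[OF assms(2,4)]) (rule assms(5))
qed

lemma metric_form_axis: "metric_form A g c x (axis i 1) (axis j 1) = g_matrix A g c x $ i $ j"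
  by (simp add: metric_form_eq_inner matrix_vector_mult_basis inner_axis' column_def)

lemma horizontal_frame_eq: "horizontal_frame A g c u i = horizontal_lift A g c u (axis i 1)"
proof -
  have "christoffel_form A g c x y (axis i 1) $ m = (\<Sum>a\<in>UNIV. y $ a * christoffel A g c x a i m)" for x y m
    by (simp add: christoffel_form_def axis_def if_distrib[of "\<lambda>z. _ * z * _"] cong: if_cong)
  then have "(\<chi> m. - (\<Sum>a\<in>UNIV. y $ a * christoffel A g c x a i m)) = - christoffel_form A g c x y (axis i 1)" for x y
    by (simp add: vec_eq_iff)
  then show ?thesis
    by (cases u) (simp add: horizontal_frame_def horizontal_lift_def snd_induced_chart)
qed

lemma vertical_frame_eq: "vertical_frame A c u i = vertical_lift A c u (axis i 1)"
  by (simp add: vertical_frame_def vertical_lift_def)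

lemma fibre_norm_eq:
  "fibre_norm A g c (p, v) = sqrt (metric_form A g c (snd c p) (v c) (v c))"
  by (simp add: fibre_norm_def snd_induced_chart metric_form_def)

section \<open>The tensors at a point: algebra, lifts under a change of charts, and the definite
  descriptions\<close>

context
  fixes A :: "('a, real ^ 'n) atlas"
    and g :: "'a \<Rightarrow> ('a, real ^ 'n) tvec \<Rightarrow> ('a, real ^ 'n) tvec \<Rightarrow> real"
  assumes atlas: "smooth_atlas A" and metric: "riemannian_metric A g"
begin

text \<open>J exchanges the two kinds of components, with factors 1/N and -N whose product is -1.
  The two summands of g2 are thereby swapped and change sign.\<close>

lemma g2_coord_J_coord:
  assumes c: "c \<in> charts_at A p" and y: "y \<noteq> 0"
  shows "g2_coord A g c (snd c p) y (J_coord A g c (snd c p) y e) (J_coord A g c (snd c p) y e')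
    = - g2_coord A g c (snd c p) y e e'"
proof -
  let ?f = "metric_form A g c (snd c p)" and ?V = "vertical_part A g c (snd c p) y"
  let ?N = "sqrt (?f y y)"
  have N: "?N \<noteq> 0" using metric_form_pos[OF atlas metric c y] by simp
  have "?f ((1 / ?N) *\<^sub>R a) (- ?N *\<^sub>R b) = - ?f b a" for a b
    using N metric_form_commute[OF atlas metric c, of b a]
    by (simp only: metric_form_scale_left metric_form_scale_right) simp
  then show ?thesis
    unfolding g2_coord_def fst_J_coord vertical_part_J_coord by (simp add: algebra_simps)
qed

lemma g2_coord_nondegenerate:
  assumes c: "c \<in> charts_at A p" and y: "y \<noteq> 0" and zero: "\<And>e'. g2_coord A g c (snd c p) y e e' = 0"
  shows "e = 0"
proof -
  let ?f = "metric_form A g c (snd c p)" and ?V = "vertical_part A g c (snd c p) y"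
  have N: "sqrt (?f y y) > 0" using metric_form_pos[OF atlas metric c y] by simp
  have eq: "?f (fst e) (?V e') + ?f (fst e') (?V e) = 0" for e'
    using zero[of e'] N by (simp add: g2_coord_def)
  \<comment> \<open>The test vector \<open>(0, b)\<close> is vertical, with vertical component b, so
    only the horizontal component of e is seen.\<close>
  have "?f (fst e) b = 0" for b
    using eq[of "(0, b)"] by (simp add: vertical_part_def christoffel_form_0 linear_0[OF linear_metric_form_left])
  then have fst: "fst e = 0"
    by (rule metric_form_nondegenerate[OF atlas metric c])
  \<comment> \<open>The vector \<open>(a, 0)\<close> is in general not horizontal, but its vertical
    component is paired with \<open>fst e\<close>, which is already zero.\<close>
  have "?f (?V e) a = 0" for a
    using eq[of "(a, 0)"] metric_form_commute[OF atlas metric c, of a "?V e"]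
    by (simp add: fst linear_0[OF linear_metric_form_left])
  then have "?V e = 0"
    by (rule metric_form_nondegenerate[OF atlas metric c])
  with fst show ?thesis
    by (simp add: vertical_part_def christoffel_form_0 prod_eq_iff)
qed

lemma horizontal_lift_linear:
  assumes "induced_chart A c \<in> charts_at (slit_tangent_bundle A) u"
  shows "horizontal_lift A g c u (r *\<^sub>R a + s *\<^sub>R b)
    = (\<lambda>d. r *\<^sub>R horizontal_lift A g c u a d + s *\<^sub>R horizontal_lift A g c u b d)"
  unfolding horizontal_lift_def coord_vector_linear[OF smooth_atlas_slit_tangent_bundle[OF atlas] assms, symmetric]
  by (simp add: christoffel_form_add christoffel_form_scale)

lemma vertical_lift_linear:
  assumes "induced_chart A c \<in> charts_at (slit_tangent_bundle A) u"
  shows "vertical_lift A c u (r *\<^sub>R a + s *\<^sub>R b)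
    = (\<lambda>d. r *\<^sub>R vertical_lift A c u a d + s *\<^sub>R vertical_lift A c u b d)"
  unfolding vertical_lift_def coord_vector_linear[OF smooth_atlas_slit_tangent_bundle[OF atlas] assms, symmetric]
  by simp

text \<open>The D^2F term in the Jacobian of the induced charts cancels against the one in
  \<open>christoffel_form_transition\<close>. This is the only place where the transformation law of
  Gamma is used.\<close>

lemma horizontal_lift_transition:
  assumes c: "c \<in> charts_at A p" and d: "d \<in> charts_at A p"
    and v: "v \<in> tangent_space A p" "v \<noteq> (\<lambda>_. 0)"
  shows "horizontal_lift A g d (p, v) (transition_deriv c d p a) = horizontal_lift A g c (p, v) a"
proof -
  have "transition_deriv (induced_chart A c) (induced_chart A d) (p, v)
      (a, - christoffel_form A g c (snd c p) (v c) a)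
    = (transition_deriv c d p a, - christoffel_form A g d (snd d p) (v d) (transition_deriv c d p a))"
    by (simp add: transition_deriv_induced_chart[OF atlas c d v] linear_neg[OF linear_transition_deriv[OF atlas c d]]
        christoffel_form_transition[OF atlas metric c d] tangent_space_transition[OF atlas v(1) c d])
  then show ?thesis
    unfolding horizontal_lift_def fst_conv snd_conv
    using coord_vector_transition[OF smooth_atlas_slit_tangent_bundle[OF atlas]
        induced_chart_in_charts_at[OF atlas c v] induced_chart_in_charts_at[OF atlas d v]]
    by metis
qed

lemma vertical_lift_transition:
  assumes c: "c \<in> charts_at A p" and d: "d \<in> charts_at A p"
    and v: "v \<in> tangent_space A p" "v \<noteq> (\<lambda>_. 0)"
  shows "vertical_lift A d (p, v) (transition_deriv c d p b) = vertical_lift A c (p, v) b"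
proof -
  have "transition_deriv2 c d p (v c) 0 = 0"
    by (rule linear_0[OF has_derivative_linear[OF has_derivative_transition_deriv_apply[OF atlas metric c d]]])
  then have "transition_deriv (induced_chart A c) (induced_chart A d) (p, v) (0, b)
    = (0, transition_deriv c d p b)"
    by (simp add: transition_deriv_induced_chart[OF atlas c d v] linear_0[OF linear_transition_deriv[OF atlas c d]])
  then show ?thesis
    unfolding vertical_lift_def
    using coord_vector_transition[OF smooth_atlas_slit_tangent_bundle[OF atlas]
        induced_chart_in_charts_at[OF atlas c v] induced_chart_in_charts_at[OF atlas d v]]
    by metis
qed

lemma fibre_norm_transition:
  assumes c: "c \<in> charts_at A p" and d: "d \<in> charts_at A p" and v: "v \<in> tangent_space A p"
  shows "fibre_norm A g d (p, v) = fibre_norm A g c (p, v)"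
  using metric_form_eq[OF atlas metric c, of "v c" "v c"] metric_form_eq[OF atlas metric d, of "v d" "v d"]
  by (simp add: fibre_norm_eq coord_vector_eq[OF atlas _ v] c d)

text \<open>The formula in chart c satisfies the description because frames of any chart d are lifts
  of Jacobian images in c; it is the only solution because the lifts of c span.\<close>

lemma g2_tilde_eq:
  assumes c: "c \<in> charts_at A p" and v: "v \<in> tangent_space A p" "v \<noteq> (\<lambda>_. 0)"
  shows "g2_tilde A g (p, v) = (\<lambda>V W.
    if V \<in> tangent_space (slit_tangent_bundle A) (p, v) \<and> W \<in> tangent_space (slit_tangent_bundle A) (p, v)
    then g2_coord A g c (snd c p) (v c) (V (induced_chart A c)) (W (induced_chart A c)) else 0)"
    (is "_ = ?b")
  unfolding g2_tilde_def fst_conv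
proof (rule the_equality)
  let ?TA = "slit_tangent_bundle A" and ?c = "induced_chart A c" and ?u = "(p, v)"
  let ?T = "tangent_space ?TA ?u" and ?f = "metric_form A g c (snd c p)"
  let ?H = "horizontal_lift A g c ?u" and ?V = "vertical_lift A c ?u" and ?N = "fibre_norm A g c ?u"
  note atlas' = smooth_atlas_slit_tangent_bundle[OF atlas]
  note c' = induced_chart_in_charts_at[OF atlas c v]
  have HT: "?H a \<in> ?T" and VT: "?V a \<in> ?T" for a
    unfolding horizontal_lift_def vertical_lift_def
    by (rule coord_vector_in_tangent_space[OF atlas' c'])+
  have Hc: "?H a ?c = (a, - christoffel_form A g c (snd c p) (v c) a)" and Vc: "?V a ?c = (0, a)" for a
    unfolding horizontal_lift_def vertical_lift_def by (simp_all add: coord_vector_self[OF atlas' c'])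
  have bHH: "?b (?H a) (?H a') = 0" and bVV: "?b (?V a) (?V a') = 0"
    and bHV: "?b (?H a) (?V a') = 2 / ?N * ?f a a'" for a a'
    by (simp_all add: HT VT Hc Vc g2_coord_def vertical_part_def christoffel_form_0 fibre_norm_eq
        linear_0[OF linear_metric_form_left] linear_0[OF linear_metric_form_right])
  show "symmetric_bilinear_on ?T ?b \<and> (\<forall>V W. V \<notin> ?T \<or> W \<notin> ?T \<longrightarrow> ?b V W = 0) \<and>
    (\<forall>d\<in>charts_at A p. \<forall>i j.
        ?b (horizontal_frame A g d ?u i) (horizontal_frame A g d ?u j) = 0 \<and>
        ?b (vertical_frame A d ?u i) (vertical_frame A d ?u j) = 0 \<and>
        ?b (horizontal_frame A g d ?u i) (vertical_frame A d ?u j)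
          = 2 / fibre_norm A g d ?u * g_matrix A g d (snd d p) $ i $ j)"
  proof (intro conjI ballI allI)
    show "symmetric_bilinear_on ?T ?b"
      unfolding symmetric_bilinear_on_def
      by (auto simp: tangent_space_combination[OF atlas'] g2_coord_linear intro: g2_coord_commute)
    show "V \<notin> ?T \<or> W \<notin> ?T \<longrightarrow> ?b V W = 0" for V W by auto
    fix d i j assume d: "d \<in> charts_at A p"
    \<comment> \<open>Rewrites the frames of d as lifts in c, where the values of the candidate form
      are known.\<close>
    note H = horizontal_lift_transition[OF d c v, symmetric]
      and V = vertical_lift_transition[OF d c v, symmetric]
    show "?b (horizontal_frame A g d ?u i) (horizontal_frame A g d ?u j) = 0"
      unfolding horizontal_frame_eq H by (rule bHH)
    show "?b (vertical_frame A d ?u i) (vertical_frame A d ?u j) = 0"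
      unfolding vertical_frame_eq V by (rule bVV)
    show "?b (horizontal_frame A g d ?u i) (vertical_frame A d ?u j)
        = 2 / fibre_norm A g d ?u * g_matrix A g d (snd d p) $ i $ j"
      unfolding horizontal_frame_eq vertical_frame_eq H V bHV
        metric_form_transition[OF atlas metric d c] metric_form_axis fibre_norm_transition[OF c d v(1)] ..
  qed
  fix b
  assume b: "symmetric_bilinear_on ?T b \<and> (\<forall>V W. V \<notin> ?T \<or> W \<notin> ?T \<longrightarrow> b V W = 0) \<and>
    (\<forall>d\<in>charts_at A p. \<forall>i j.
        b (horizontal_frame A g d ?u i) (horizontal_frame A g d ?u j) = 0 \<and>
        b (vertical_frame A d ?u i) (vertical_frame A d ?u j) = 0 \<and>
        b (horizontal_frame A g d ?u i) (vertical_frame A d ?u j)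
          = 2 / fibre_norm A g d ?u * g_matrix A g d (snd d p) $ i $ j)"
  have sym: "b V W = b W V" if "V \<in> ?T" "W \<in> ?T" for V W
    using b that unfolding symmetric_bilinear_on_def by blast
  have left: "b (\<lambda>d. r *\<^sub>R V d + s *\<^sub>R V' d) W = r * b V W + s * b V' W"
    if "V \<in> ?T" "V' \<in> ?T" "W \<in> ?T" for r s V V' W
    using b that unfolding symmetric_bilinear_on_def by blast
  have right: "b W (\<lambda>d. r *\<^sub>R V d + s *\<^sub>R V' d) = r * b W V + s * b W V'"
    if "V \<in> ?T" "V' \<in> ?T" "W \<in> ?T" for r s V V' W
    using left[OF that] sym[OF that(3)] tangent_space_combination[OF atlas' that(1,2)] that(1,2) by simp
  \<comment> \<open>The combination law with both factors 1 gives additivity, and with the second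
    factor 0 it gives homogeneity.\<close>
  have linH: "linear (\<lambda>a. b (?H a) W)" and linV: "linear (\<lambda>a. b (?V a) W)" if "W \<in> ?T" for W
    using left[OF HT HT that, of 1 _ 1] left[OF HT HT that, of _ _ 0]
      left[OF VT VT that, of 1 _ 1] left[OF VT VT that, of _ _ 0]
      horizontal_lift_linear[OF c', of 1 _ 1] horizontal_lift_linear[OF c', of _ _ 0]
      vertical_lift_linear[OF c', of 1 _ 1] vertical_lift_linear[OF c', of _ _ 0]
    by (auto intro!: linearI)
  have linH': "linear (\<lambda>a. b W (?H a))" and linV': "linear (\<lambda>a. b W (?V a))" if "W \<in> ?T" for W
    using linH[OF that] linV[OF that] sym[OF that HT] sym[OF that VT] by simp_all
  have HH: "b (?H a) (?H a') = 0" for a a'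
    by (rule bilinear_eq_on_axis[of "\<lambda>a a'. b (?H a) (?H a')" "\<lambda>_ _. 0"])
      (use b c in \<open>auto simp: linH linH' HT linear_zero horizontal_frame_eq[symmetric]\<close>)
  have VV: "b (?V a) (?V a') = 0" for a a'
    by (rule bilinear_eq_on_axis[of "\<lambda>a a'. b (?V a) (?V a')" "\<lambda>_ _. 0"])
      (use b c in \<open>auto simp: linV linV' VT linear_zero vertical_frame_eq[symmetric]\<close>)
  have linf: "linear (\<lambda>a. 2 / ?N * ?f a a')" "linear (\<lambda>a. 2 / ?N * ?f a' a)" for a'
    using linear_compose_scale_right[OF linear_metric_form_left[of A g c "snd c p" a'], of "2 / ?N"]
      linear_compose_scale_right[OF linear_metric_form_right[of A g c "snd c p" a'], of "2 / ?N"]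
    by simp_all
  have HV: "b (?H a) (?V a') = 2 / ?N * ?f a a'" for a a'
    by (rule bilinear_eq_on_axis[of "\<lambda>a a'. b (?H a) (?V a')" "\<lambda>a a'. 2 / ?N * ?f a a'",
          OF linH[OF VT] linV'[OF HT] linf])
      (use b c in \<open>simp add: metric_form_axis horizontal_frame_eq[symmetric] vertical_frame_eq[symmetric]\<close>)
  have "b V W = ?b V W" if V: "V \<in> ?T" and W: "W \<in> ?T" for V W
  proof -
    define h w where "h V = fst (V ?c)" and "w V = vertical_part A g c (snd c p) (v c) (V ?c)" for V
    \<comment> \<open>Splits V into lifts of its components; equality is checked in the single chart
      \<open>?c\<close>. The factors 1 match the form of the bilinearity law.\<close>
    have dec: "V = (\<lambda>d. 1 *\<^sub>R ?H (h V) d + 1 *\<^sub>R ?V (w V) d)" if "V \<in> ?T" for V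
      by (rule tangent_vector_eqI[OF atlas' c' that tangent_space_combination[OF atlas' HT VT]])
        (simp add: Hc Vc h_def w_def vertical_part_def prod_eq_iff)
    have "b V W = b (\<lambda>d. 1 *\<^sub>R ?H (h V) d + 1 *\<^sub>R ?V (w V) d) (\<lambda>d. 1 *\<^sub>R ?H (h W) d + 1 *\<^sub>R ?V (w W) d)"
      using dec[OF V] dec[OF W] by metis
    \<comment> \<open>Only the pairing of horizontal with vertical vectors is prescribed; symmetry
      of b supplies the opposite order.\<close>
    also have "\<dots> = 2 / ?N * ?f (h V) (w W) + 2 / ?N * ?f (h W) (w V)"
      unfolding left[OF HT VT tangent_space_combination[OF atlas' HT VT]]
        right[OF HT VT HT] right[OF HT VT VT] sym[OF VT HT] HH VV HV by simp
    also have "\<dots> = ?b V W"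
      using V W by (simp add: g2_coord_def fibre_norm_eq h_def w_def distrib_left)
    finally show ?thesis .
  qed
  moreover have "b V W = ?b V W" if "V \<notin> ?T \<or> W \<notin> ?T" for V W
    using b that by auto
  ultimately show "b = ?b" by blast
qed

text \<open>The same scheme as for the metric, with linear maps in place of bilinear forms: frames
  of other charts become lifts in c, and an endomorphism is determined by its values on the
  lifts.\<close>

lemma J_tilde_eq:
  assumes c: "c \<in> charts_at A p" and v: "v \<in> tangent_space A p" "v \<noteq> (\<lambda>_. 0)"
  shows "J_tilde A g (p, v) = (\<lambda>V.
    if V \<in> tangent_space (slit_tangent_bundle A) (p, v)
    then coord_vector (slit_tangent_bundle A) (induced_chart A c) (p, v)
      (J_coord A g c (snd c p) (v c) (V (induced_chart A c))) else (\<lambda>_. 0))"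
    (is "_ = ?F")
  unfolding J_tilde_def fst_conv
proof (rule the_equality)
  let ?TA = "slit_tangent_bundle A" and ?c = "induced_chart A c" and ?u = "(p, v)"
  let ?T = "tangent_space ?TA ?u"
  let ?H = "horizontal_lift A g c ?u" and ?V = "vertical_lift A c ?u" and ?N = "fibre_norm A g c ?u"
  let ?C = "coord_vector ?TA ?c ?u"
  note atlas' = smooth_atlas_slit_tangent_bundle[OF atlas]
  note c' = induced_chart_in_charts_at[OF atlas c v]
  have CT: "?C e \<in> ?T" for e by (rule coord_vector_in_tangent_space[OF atlas' c'])
  then have HT: "?H a \<in> ?T" and VT: "?V a \<in> ?T" for a
    by (simp_all add: horizontal_lift_def vertical_lift_def)
  have Hc: "?H a ?c = (a, - christoffel_form A g c (snd c p) (v c) a)" and Vc: "?V a ?c = (0, a)" for a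
    unfolding horizontal_lift_def vertical_lift_def by (simp_all add: coord_vector_self[OF atlas' c'])
  have Hscale: "?H (r *\<^sub>R a) = (\<lambda>d. r *\<^sub>R ?H a d)" and Vscale: "?V (r *\<^sub>R a) = (\<lambda>d. r *\<^sub>R ?V a d)" for r a
    using horizontal_lift_linear[OF c', of r a 0] vertical_lift_linear[OF c', of r a 0] by simp_all
  have FH: "?F (?H a) = (\<lambda>d. - ?N *\<^sub>R ?V a d)" for a
  proof -
    have "?F (?H a) = ?V (- ?N *\<^sub>R a)"
      by (simp add: HT Hc J_coord_def vertical_part_def christoffel_form_0 fibre_norm_eq vertical_lift_def)
    then show ?thesis by (simp only: Vscale)
  qed
  have FV: "?F (?V a) = (\<lambda>d. (1 / ?N) *\<^sub>R ?H a d)" for a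
  proof -
    have "?F (?V a) = ?H ((1 / ?N) *\<^sub>R a)"
      by (simp add: VT Vc J_coord_def vertical_part_def christoffel_form_0 fibre_norm_eq horizontal_lift_def)
    then show ?thesis by (simp only: Hscale)
  qed
  show "endomorphism_on ?T ?F \<and> (\<forall>V. V \<notin> ?T \<longrightarrow> ?F V = (\<lambda>_. 0)) \<and>
    (\<forall>d\<in>charts_at A p. \<forall>i.
        ?F (horizontal_frame A g d ?u i) = (\<lambda>e. - fibre_norm A g d ?u *\<^sub>R vertical_frame A d ?u i e) \<and>
        ?F (vertical_frame A d ?u i) = (\<lambda>e. (1 / fibre_norm A g d ?u) *\<^sub>R horizontal_frame A g d ?u i e))"
  proof (intro conjI ballI allI)
    show "endomorphism_on ?T ?F"
      unfolding endomorphism_on_def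
      by (simp add: CT tangent_space_combination[OF atlas'] J_coord_linear coord_vector_linear[OF atlas' c'])
    show "V \<notin> ?T \<longrightarrow> ?F V = (\<lambda>_. 0)" for V by simp
    fix d i assume d: "d \<in> charts_at A p"
    note H = horizontal_lift_transition[OF d c v, symmetric]
      and V = vertical_lift_transition[OF d c v, symmetric]
    show "?F (horizontal_frame A g d ?u i) = (\<lambda>e. - fibre_norm A g d ?u *\<^sub>R vertical_frame A d ?u i e)"
      unfolding horizontal_frame_eq vertical_frame_eq H V fibre_norm_transition[OF c d v(1)] by (rule FH)
    show "?F (vertical_frame A d ?u i) = (\<lambda>e. (1 / fibre_norm A g d ?u) *\<^sub>R horizontal_frame A g d ?u i e)"
      unfolding horizontal_frame_eq vertical_frame_eq H V fibre_norm_transition[OF c d v(1)] by (rule FV)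
  qed
  fix f
  assume f: "endomorphism_on ?T f \<and> (\<forall>V. V \<notin> ?T \<longrightarrow> f V = (\<lambda>_. 0)) \<and>
    (\<forall>d\<in>charts_at A p. \<forall>i.
        f (horizontal_frame A g d ?u i) = (\<lambda>e. - fibre_norm A g d ?u *\<^sub>R vertical_frame A d ?u i e) \<and>
        f (vertical_frame A d ?u i) = (\<lambda>e. (1 / fibre_norm A g d ?u) *\<^sub>R horizontal_frame A g d ?u i e))"
  have lin: "f (\<lambda>d. r *\<^sub>R V d + s *\<^sub>R W d) = (\<lambda>d. r *\<^sub>R f V d + s *\<^sub>R f W d)"
    if "V \<in> ?T" "W \<in> ?T" for r s V W
    using f that unfolding endomorphism_on_def by blast
  have Flin: "?F (\<lambda>d. r *\<^sub>R V d + s *\<^sub>R W d) = (\<lambda>d. r *\<^sub>R ?F V d + s *\<^sub>R ?F W d)"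
    if "V \<in> ?T" "W \<in> ?T" for r s V W
    using that by (simp add: tangent_space_combination[OF atlas'] J_coord_linear coord_vector_linear[OF atlas' c'])
  \<comment> \<open>Vector operations on tangent vectors are pointwise, so linearity is stated for
    the value at each chart d separately.\<close>
  have Hlin: "linear (\<lambda>a. ?H a d)" and Vlin: "linear (\<lambda>a. ?V a d)" for d
    using fun_cong[OF horizontal_lift_linear[OF c', of 1 _ 1]] fun_cong[OF horizontal_lift_linear[OF c', of _ _ 0]]
      fun_cong[OF vertical_lift_linear[OF c', of 1 _ 1]] fun_cong[OF vertical_lift_linear[OF c', of _ _ 0]]
    by (intro linearI; simp)+
  have fHlin: "linear (\<lambda>a. f (?H a) d)" and fVlin: "linear (\<lambda>a. f (?V a) d)" for d
    using fun_cong[OF lin[OF HT HT, of 1 _ 1]] fun_cong[OF lin[OF HT HT, of _ _ 0]]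
      fun_cong[OF lin[OF VT VT, of 1 _ 1]] fun_cong[OF lin[OF VT VT, of _ _ 0]]
      horizontal_lift_linear[OF c', of 1 _ 1] horizontal_lift_linear[OF c', of _ _ 0]
      vertical_lift_linear[OF c', of 1 _ 1] vertical_lift_linear[OF c', of _ _ 0]
    by (intro linearI; simp)+
  have fH: "f (?H a) = ?F (?H a)" for a
    unfolding FH
  proof
    fix d
    show "f (?H a) d = - ?N *\<^sub>R ?V a d"
      by (rule linear_eq_on_axis[OF fHlin linear_compose_scale_right[OF Vlin]])
        (use f c in \<open>simp add: horizontal_frame_eq[symmetric] vertical_frame_eq[symmetric]\<close>)
  qed
  have fV: "f (?V a) = ?F (?V a)" for a
    unfolding FV
  proof
    fix d
    show "f (?V a) d = (1 / ?N) *\<^sub>R ?H a d"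
      by (rule linear_eq_on_axis[OF fVlin linear_compose_scale_right[OF Hlin]])
        (use f c in \<open>simp add: horizontal_frame_eq[symmetric] vertical_frame_eq[symmetric]\<close>)
  qed
  have "f V = ?F V" if V: "V \<in> ?T" for V
  proof -
    define h w where "h = fst (V ?c)" and "w = vertical_part A g c (snd c p) (v c) (V ?c)"
    have V': "V = (\<lambda>d. 1 *\<^sub>R ?H h d + 1 *\<^sub>R ?V w d)"
      by (rule tangent_vector_eqI[OF atlas' c' V tangent_space_combination[OF atlas' HT VT]])
        (simp add: Hc Vc h_def w_def vertical_part_def prod_eq_iff)
    show ?thesis
      unfolding V' lin[OF HT VT] Flin[OF HT VT] fH fV ..
  qed
  moreover have "f V = ?F V" if "V \<notin> ?T" for V
    using f that by simp
  ultimately show "f = ?F" by blast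
qed

end

section \<open>Smoothness and the defining identities on the slit tangent bundle\<close>

context
  fixes A :: "('a, real ^ 'n) atlas"
    and g :: "'a \<Rightarrow> ('a, real ^ 'n) tvec \<Rightarrow> ('a, real ^ 'n) tvec \<Rightarrow> real"
  assumes atlas: "smooth_atlas A" and metric: "riemannian_metric A g"
begin

lemma smooth_metric_form_compose:
  assumes c: "c \<in> A" and S: "open S" "X ` S \<subseteq> chart_image c"
    and X: "smooth_on S X" and f: "smooth_on S f" and h: "smooth_on S h"
  shows "smooth_on S (\<lambda>z. metric_form A g c (X z) (f z) (h z))"
  unfolding metric_form_def
  by (intro smooth_on_sum smooth_on_mult smooth_on_vec_nth S f h
      smooth_on_compose[OF S(1) open_chart_image[OF atlas c] S(2) X smooth_g_matrix[OF atlas metric c]])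

lemma smooth_christoffel_form_compose:
  assumes c: "c \<in> A" and S: "open S" "X ` S \<subseteq> chart_image c"
    and X: "smooth_on S X" and f: "smooth_on S f" and h: "smooth_on S h"
  shows "smooth_on S (\<lambda>z. christoffel_form A g c (X z) (f z) (h z))"
  unfolding christoffel_form_def
  by (intro smooth_on_vec_lambda smooth_on_sum smooth_on_mult smooth_on_vec_nth S f h
      smooth_on_compose[OF S(1) open_chart_image[OF atlas c] S(2) X smooth_christoffel[OF atlas metric c]])

lemma slit_chart_image_point:
  assumes c: "c \<in> A" and z: "z \<in> chart_image (induced_chart A c)"
  obtains p v where "c \<in> charts_at A p" "v \<in> tangent_space A p" "v \<noteq> (\<lambda>_. 0)"
    "chart_inv (induced_chart A c) z = (p, v)" "snd c p = fst z" "v c = snd z" "snd z \<noteq> 0"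
proof -
  obtain p v where u: "chart_inv (induced_chart A c) z = (p, v)" by fastforce
  then have "(p, v) \<in> fst (induced_chart A c)" using chart_inv_into[OF z] by simp
  then have pv: "c \<in> charts_at A p" "v \<in> tangent_space A p" "v \<noteq> (\<lambda>_. 0)"
    using c by (simp_all add: fst_induced_chart charts_at_iff)
  moreover have "(snd c p, v c) = z"
    using snd_chart_inv[OF z] unfolding u snd_induced_chart .
  ultimately show thesis
    using that[OF pv u] tangent_vector_eq_0_iff[OF atlas pv(1,2)] by auto
qed

lemma
  assumes c: "c \<in> A"
  shows smooth_g2_coord:
      "smooth_on (chart_image (induced_chart A c)) (\<lambda>z. g2_coord A g c (fst z) (snd z) e e')"
    and smooth_J_coord:
      "smooth_on (chart_image (induced_chart A c)) (\<lambda>z. J_coord A g c (fst z) (snd z) e)"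
proof -
  let ?S = "chart_image (induced_chart A c)"
  have S: "open ?S"
    using open_chart_image[OF smooth_atlas_slit_tangent_bundle[OF atlas]] c
    by (simp add: slit_tangent_bundle_def)
  have sub: "fst ` ?S \<subseteq> chart_image c"
    by (auto simp: chart_image_induced_chart[OF atlas c])
  have fst: "smooth_on ?S fst" and snd: "smooth_on ?S snd"
    by (intro smooth_on_bounded_linear[OF S] bounded_linear_fst bounded_linear_snd)+
  note const = smooth_on_const[OF S]
  note form = smooth_metric_form_compose[OF c S sub fst]
  note Gamma = smooth_christoffel_form_compose[OF c S sub fst snd]
  \<comment> \<open>Points of an induced chart have nonzero fibre coordinate. The square root and
    the division by N are smooth only because of this.\<close>
  have pos: "metric_form A g c (fst z) (snd z) (snd z) > 0" if z: "z \<in> ?S" for z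
    by (rule slit_chart_image_point[OF c z]) (metis metric_form_pos[OF atlas metric])
  have N: "smooth_on ?S (\<lambda>z. sqrt (metric_form A g c (fst z) (snd z) (snd z)))"
    by (rule smooth_on_sqrt[OF S pos form[OF snd snd]])
  have inv: "smooth_on ?S (\<lambda>z. r / sqrt (metric_form A g c (fst z) (snd z) (snd z)))" for r
    by (rule smooth_on_divide[OF S _ const N]) (use pos in force)
  have V: "smooth_on ?S (\<lambda>z. vertical_part A g c (fst z) (snd z) e)" for e
    unfolding vertical_part_def by (intro smooth_on_add[OF S] const Gamma)
  show "smooth_on ?S (\<lambda>z. g2_coord A g c (fst z) (snd z) e e')"
    unfolding g2_coord_def by (intro smooth_on_mult[OF S] smooth_on_add[OF S] inv form const V)
  show "smooth_on ?S (\<lambda>z. J_coord A g c (fst z) (snd z) e)"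
    unfolding J_coord_def
    by (intro smooth_on_Pair[OF S] smooth_on_diff[OF S] smooth_on_scaleR[OF S] smooth_on_uminus[OF S]
        inv N V const Gamma)
qed

lemma slit_tangent_bundle_point:
  assumes "u \<in> carrier (slit_tangent_bundle A)"
  obtains c p v where "u = (p, v)" "c \<in> charts_at A p" "v \<in> tangent_space A p" "v \<noteq> (\<lambda>_. 0)" "v c \<noteq> 0"
proof -
  obtain p v where u: "u = (p, v)" by fastforce
  then have v: "v \<in> tangent_space A p" "v \<noteq> (\<lambda>_. 0)" "p \<in> carrier A"
    using assms by (simp_all add: carrier_slit_tangent_bundle[OF atlas])
  then obtain c where "c \<in> charts_at A p" by (meson carrier_iff)
  then show thesis
    using that u v tangent_vector_eq_0_iff[OF atlas] by blast
qed

lemma pseudo_riemannian_metric_g2_tilde: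
  "pseudo_riemannian_metric (slit_tangent_bundle A) (g2_tilde A g)"
proof -
  let ?TA = "slit_tangent_bundle A"
  note atlas' = smooth_atlas_slit_tangent_bundle[OF atlas]
  have bil: "symmetric_bilinear_on (tangent_space ?TA u) (g2_tilde A g u)" if "u \<in> carrier ?TA" for u
  proof -
    obtain c p v where u: "u = (p, v)" and c: "c \<in> charts_at A p" "v \<in> tangent_space A p" "v \<noteq> (\<lambda>_. 0)"
      using slit_tangent_bundle_point[OF \<open>u \<in> carrier ?TA\<close>] by metis
    show ?thesis
      unfolding u g2_tilde_eq[OF atlas metric c] symmetric_bilinear_on_def
      by (auto simp: tangent_space_combination[OF atlas'] g2_coord_linear intro: g2_coord_commute)
  qed
  have smooth: "smooth_on (chart_image d) (\<lambda>z. g2_tilde A g (chart_inv d z)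
      (coord_vector ?TA d (chart_inv d z) e) (coord_vector ?TA d (chart_inv d z) e'))"
    if "d \<in> ?TA" for d e e'
  proof -
    obtain c where c: "c \<in> A" "d = induced_chart A c"
      using \<open>d \<in> ?TA\<close> by (auto simp: slit_tangent_bundle_def)
    \<comment> \<open>For fixed coordinates e and e', the components of \<open>g2_tilde\<close> in
      the chart induced by c are given by one formula over its whole image, so smoothness carries
      over.\<close>
    have "g2_coord A g c (fst z) (snd z) e e' = g2_tilde A g (chart_inv d z)
      (coord_vector ?TA d (chart_inv d z) e) (coord_vector ?TA d (chart_inv d z) e')"
      if "z \<in> chart_image d" for z
    proof -
      obtain p v where pv: "c \<in> charts_at A p" "v \<in> tangent_space A p" "v \<noteq> (\<lambda>_. 0)"
        "chart_inv d z = (p, v)" "snd c p = fst z" "v c = snd z"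
        by (rule slit_chart_image_point[OF c(1) \<open>z \<in> chart_image d\<close>[unfolded c(2)], folded c(2)])
      note c' = induced_chart_in_charts_at[OF atlas pv(1-3)]
      show ?thesis
        unfolding pv(4) g2_tilde_eq[OF atlas metric pv(1-3)]
        by (simp add: c(2) pv(5,6) coord_vector_self[OF atlas' c'] coord_vector_in_tangent_space[OF atlas' c'])
    qed
    then show ?thesis
      using smooth_g2_coord[OF c(1)] open_chart_image[OF atlas' that] unfolding c(2)
      by (rule smooth_on_cong[rotated])
  qed
  have nondeg: "V = (\<lambda>_. 0)" if u: "u \<in> carrier ?TA" and V: "V \<in> tangent_space ?TA u"
    and zero: "\<forall>W\<in>tangent_space ?TA u. g2_tilde A g u V W = 0" for u V
  proof -
    obtain c p v where uu: "u = (p, v)" and c: "c \<in> charts_at A p" "v \<in> tangent_space A p" "v \<noteq> (\<lambda>_. 0)"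
      and y: "v c \<noteq> 0"
      using slit_tangent_bundle_point[OF u] by metis
    let ?c = "induced_chart A c"
    note c' = induced_chart_in_charts_at[OF atlas c]
    \<comment> \<open>Every pair of coordinates e is realised by a tangent vector, so vanishing on
      the tangent space gives vanishing for all e.\<close>
    have "g2_coord A g c (snd c p) (v c) (V ?c) e = 0" for e
    proof -
      have "coord_vector ?TA ?c (p, v) e \<in> tangent_space ?TA (p, v)"
        by (rule coord_vector_in_tangent_space[OF atlas' c'])
      with zero V show ?thesis
        unfolding uu g2_tilde_eq[OF atlas metric c]
        by (metis (mono_tags, lifting) coord_vector_self[OF atlas' c'])
    qed
    then have "V ?c = 0"
      by (rule g2_coord_nondegenerate[OF atlas metric c(1) y])
    then show ?thesis
      using tangent_vector_eq_0_iff[OF atlas' c'] V uu by blast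
  qed
  show ?thesis
    unfolding pseudo_riemannian_metric_def symmetric_tensor_field_def
    using bil smooth nondeg by blast
qed

lemma tensor_field_J_tilde: "tensor_field_11 (slit_tangent_bundle A) (J_tilde A g)"
proof -
  let ?TA = "slit_tangent_bundle A"
  note atlas' = smooth_atlas_slit_tangent_bundle[OF atlas]
  have endo: "endomorphism_on (tangent_space ?TA u) (J_tilde A g u)" if "u \<in> carrier ?TA" for u
  proof -
    obtain c p v where u: "u = (p, v)" and c: "c \<in> charts_at A p" "v \<in> tangent_space A p" "v \<noteq> (\<lambda>_. 0)"
      using slit_tangent_bundle_point[OF \<open>u \<in> carrier ?TA\<close>] by metis
    note c' = induced_chart_in_charts_at[OF atlas c]
    show ?thesis
      unfolding u J_tilde_eq[OF atlas metric c] endomorphism_on_def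
      by (simp add: coord_vector_in_tangent_space[OF atlas' c'] tangent_space_combination[OF atlas']
          J_coord_linear coord_vector_linear[OF atlas' c'])
  qed
  have smooth: "smooth_on (chart_image d)
      (\<lambda>z. J_tilde A g (chart_inv d z) (coord_vector ?TA d (chart_inv d z) e) d)"
    if "d \<in> ?TA" for d e
  proof -
    obtain c where c: "c \<in> A" "d = induced_chart A c"
      using \<open>d \<in> ?TA\<close> by (auto simp: slit_tangent_bundle_def)
    have "J_coord A g c (fst z) (snd z) e
      = J_tilde A g (chart_inv d z) (coord_vector ?TA d (chart_inv d z) e) d"
      if "z \<in> chart_image d" for z
    proof -
      obtain p v where pv: "c \<in> charts_at A p" "v \<in> tangent_space A p" "v \<noteq> (\<lambda>_. 0)"
        "chart_inv d z = (p, v)" "snd c p = fst z" "v c = snd z"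
        by (rule slit_chart_image_point[OF c(1) \<open>z \<in> chart_image d\<close>[unfolded c(2)], folded c(2)])
      note c' = induced_chart_in_charts_at[OF atlas pv(1-3)]
      show ?thesis
        unfolding pv(4) J_tilde_eq[OF atlas metric pv(1-3)]
        by (simp add: c(2) pv(5,6) coord_vector_self[OF atlas' c'] coord_vector_in_tangent_space[OF atlas' c'])
    qed
    then show ?thesis
      using smooth_J_coord[OF c(1)] open_chart_image[OF atlas' that] unfolding c(2)
      by (rule smooth_on_cong[rotated])
  qed
  show ?thesis
    unfolding tensor_field_11_def using endo smooth by blast
qed

lemma
  assumes u: "u \<in> carrier (slit_tangent_bundle A)"
    and V: "V \<in> tangent_space (slit_tangent_bundle A) u" and W: "W \<in> tangent_space (slit_tangent_bundle A) u"
  shows J_tilde_J_tilde: "J_tilde A g u (J_tilde A g u V) = (\<lambda>d. - V d)"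
    and g2_tilde_J_tilde: "g2_tilde A g u (J_tilde A g u V) (J_tilde A g u W) = - g2_tilde A g u V W"
proof -
  let ?TA = "slit_tangent_bundle A"
  note atlas' = smooth_atlas_slit_tangent_bundle[OF atlas]
  obtain c p v where uu: "u = (p, v)" and c: "c \<in> charts_at A p" "v \<in> tangent_space A p" "v \<noteq> (\<lambda>_. 0)"
    and y: "v c \<noteq> 0"
    using slit_tangent_bundle_point[OF u] by metis
  let ?c = "induced_chart A c" and ?J = "J_coord A g c (snd c p) (v c)"
  let ?C = "coord_vector ?TA ?c (p, v)"
  note c' = induced_chart_in_charts_at[OF atlas c]
  note C = coord_vector_in_tangent_space[OF atlas' c'] coord_vector_self[OF atlas' c']
  have VW: "V \<in> tangent_space ?TA (p, v)" "W \<in> tangent_space ?TA (p, v)"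
    using V W uu by simp_all
  \<comment> \<open>The negative is written as a linear combination to fit
    \<open>coord_vector_linear\<close>.\<close>
  have "?C (?J (?J (V ?c))) = ?C ((-1) *\<^sub>R V ?c + 0 *\<^sub>R V ?c)"
    using J_coord_J_coord[OF metric_form_pos[OF atlas metric c(1) y]] by simp
  also have "\<dots> = (\<lambda>d. - V d)"
    unfolding coord_vector_linear[OF atlas' c'] coord_vector_eq[OF atlas' c' VW(1)] by simp
  finally show "J_tilde A g u (J_tilde A g u V) = (\<lambda>d. - V d)"
    by (simp add: uu J_tilde_eq[OF atlas metric c] VW C)
  show "g2_tilde A g u (J_tilde A g u V) (J_tilde A g u W) = - g2_tilde A g u V W"
    by (simp add: uu J_tilde_eq[OF atlas metric c] g2_tilde_eq[OF atlas metric c] VW C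
        g2_coord_J_coord[OF atlas metric c(1) y])
qed

end

theorem theorem5:
  fixes A :: "('a, real ^ 'n) atlas"
    and g :: "'a \<Rightarrow> ('a, real ^ 'n) tvec \<Rightarrow> ('a, real ^ 'n) tvec \<Rightarrow> real"
  assumes "smooth_manifold A"
    and "riemannian_metric A g"
  shows "almost_anti_hermitian (slit_tangent_bundle A) (g2_tilde A g) (J_tilde A g)"
proof -
  have atlas: "smooth_atlas A" using assms(1) by (simp add: smooth_manifold_def)
  have "smooth_manifold (slit_tangent_bundle A)"
    using assms(1) smooth_manifold_slit_tangent_bundle[OF atlas] by (simp add: smooth_manifold_def)
  then show ?thesis
    unfolding almost_anti_hermitian_def
    using pseudo_riemannian_metric_g2_tilde[OF atlas assms(2)] tensor_field_J_tilde[OF atlas assms(2)]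
      J_tilde_J_tilde[OF atlas assms(2)] g2_tilde_J_tilde[OF atlas assms(2)]
    \<comment> \<open>The identity for vector fields is the pointwise one at \<open>X p\<close> and
      \<open>Y p\<close>; \<open>vector_field\<close> supplies that these are tangent vectors at
      p.\<close>
    by (auto simp: vector_field_def)
qed

end
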